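(* Let $G$ be a graph with vertex set $V(G)=\{x_1,\dots,x_n\}$, let $\mathbb{K}$ be a field, let $S=\mathbb{K}[x_1,\dots,x_n]$, and let $J(G)\subseteq S$ be the cover ideal of $G$. Let $\nu_o(G)$ be the ordered matching number of $G$. Then: (i) $\mathrm{sdepth}(J(G))\geq n-\nu_o(G)$ and $\mathrm{sdepth}(S/J(G))\geq n-\nu_o(G)-1$; (ii) $\mathrm{depth}(S/J(G))\geq n-\nu_o(G)-1$.
   Context: Graphs are finite and simple; the vertices of $G$ are identified with the variables of $S$. Cover ideal: $J(G)=\bigcap_{\{x_i,x_j\}\in E(G)}(x_i,x_j)\subseteq S$ (so $J(G)=S$ if $G$ has no edges). Equivalently, $J(G)$ is generated by the squarefree monomials $\prod_{x_i\in C}x_i$ with $C$ a (minimal) vertex cover of $G$. Ordered matching: a nonempty matching $M=\{\{a_i,b_i\}\mid 1\leq i\leq r\}$ of $G$ (a set of pairwise disjoint edges, with a chosen labelling of the edges and their endpoints) is an ordered matching if (1) $\{a_1,\dots,a_r\}$ is an independent set of vertices of $G$, and (2) $\{a_i,b_j\}\in E(G)$ implies $i\leq j$. The ordered matching number $\nu_o(G)$ is the maximum of $|M|$ over all ordered matchings $M$ of $G$, with $\nu_o(G)=0$ if $G$ has no edges. Stanley depth: let $M$ be a finitely generated $\mathbb{Z}^n$-graded $S$-module. For a homogeneous element $u\in M$ and $Z\subseteq\{x_1,\dots,x_n\}$, the $\mathbb{K}$-subspace $u\mathbb{K}[Z]$ generated by all $uv$ with $v\in\mathbb{K}[Z]$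 is called a Stanley space of dimension $|Z|$ if it is a free $\mathbb{K}[Z]$-module. A Stanley decomposition $\mathcal{D}$ of $M$ is a decomposition of $M$ as a finite direct sum (of $\mathbb{K}$-vector spaces) of Stanley spaces; $\mathrm{sdepth}(\mathcal{D})$ is the minimum dimension of a Stanley space in $\mathcal{D}$; and $\mathrm{sdepth}(M)$ is the maximum of $\mathrm{sdepth}(\mathcal{D})$ over all Stanley decompositions $\mathcal{D}$ of $M$. Depth is with respect to the ideal $(x_1,\dots,x_n)$. The depth and Stanley depth of the zero module are $+\infty$ by convention. *)

theory Defs
  imports
    "HOL-Library.Poly_Mapping"
    "HOL-Library.Extended_Nat"
    "HOL-Library.Ramsey"
    "HOL-Algebra.QuotRing"
    "HOL-Algebra.Module"
begin

section \<open>Graphs and ordered matchings\<close>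

definition simple_graph :: "'v set \<Rightarrow> 'v set set \<Rightarrow> bool" where
  "simple_graph V E \<longleftrightarrow> finite V \<and> (\<forall>e\<in>E. e \<subseteq> V \<and> card e = 2)"

text \<open>The matching is \<open>{a 1, b 1}, \<dots>, {a r, b r}\<close>; since the edges are pairwise disjoint, \<open>r\<close> is
  its cardinality. \<^const>\<open>indep\<close> is the notion of independent set of \<^theory>\<open>HOL-Library.Ramsey\<close>.\<close>

definition ordered_matching :: "'v set set \<Rightarrow> nat \<Rightarrow> (nat \<Rightarrow> 'v) \<Rightarrow> (nat \<Rightarrow> 'v) \<Rightarrow> bool" where
  "ordered_matching E r a b \<longleftrightarrow>
     r \<ge> 1 \<and>
     (\<forall>i\<in>{1..r}. {a i, b i} \<in> E) \<and>
     (\<forall>i\<in>{1..r}. \<forall>j\<in>{1..r}. i \<noteq> j \<longrightarrow> {a i, b i} \<inter> {a j, b j} = {}) \<and>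
     indep (a ` {1..r}) E \<and>
     (\<forall>i\<in>{1..r}. \<forall>j\<in>{1..r}. {a i, b j} \<in> E \<longrightarrow> i \<le> j)"

definition ordered_matching_number :: "'v set set \<Rightarrow> nat" where
  "ordered_matching_number E =
     (if E = {} then 0 else Max {r. \<exists>a b. ordered_matching E r a b})"


section \<open>Polynomial rings in the variables of a set\<close>

text \<open>A monomial is its exponent function of type \<open>'v \<Rightarrow>\<^sub>0 nat\<close>, a polynomial is a finitely supported
  coefficient function on monomials.\<close>

type_synonym ('v, 'k) mpoly = "('v \<Rightarrow>\<^sub>0 nat) \<Rightarrow>\<^sub>0 'k"

definition polys_in :: "'v set \<Rightarrow> ('v, 'k::zero) mpoly set" where
  "polys_in Z = {p. \<forall>m\<in>Poly_Mapping.keys p. Poly_Mapping.keys m \<subseteq> Z}"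

definition poly_ring :: "'v set \<Rightarrow> ('v, 'k::field) mpoly ring" where
  "poly_ring V = \<lparr>carrier = polys_in V, mult = (*), one = 1, zero = 0, add = (+)\<rparr>"

definition pvar :: "'v \<Rightarrow> ('v, 'k::field) mpoly" where
  "pvar x = Poly_Mapping.single (Poly_Mapping.single x 1) 1"

text \<open>The multidegrees are the functions \<open>a :: 'v \<Rightarrow> int\<close>; the component of a multidegree that is
  negative somewhere or nonzero outside \<open>V\<close> is \<open>{0}\<close>.\<close>

definition poly_component :: "'v set \<Rightarrow> ('v \<Rightarrow> int) \<Rightarrow> ('v, 'k::field) mpoly set" where
  "poly_component V a =
     {p \<in> polys_in V. \<forall>m\<in>Poly_Mapping.keys p. \<forall>x. int (Poly_Mapping.lookup m x) = a x}"


section \<open>Ideals and cyclic quotients as modules\<close>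

text \<open>The fields \<^const>\<open>mult\<close> and \<^const>\<open>one\<close> of a module record are irrelevant to its module
  structure.\<close>

definition ideal_module :: "('a, 'b) ring_scheme \<Rightarrow> 'a set \<Rightarrow> ('a, 'a) module" where
  "ideal_module R I =
     \<lparr>carrier = I, mult = mult R, one = one R, zero = zero R, add = add R, smult = mult R\<rparr>"

definition quotient_module :: "('a, 'b) ring_scheme \<Rightarrow> 'a set \<Rightarrow> ('a, 'a set) module" where
  "quotient_module R I =
     \<lparr>carrier = carrier (R Quot I), mult = mult (R Quot I), one = one (R Quot I),
      zero = zero (R Quot I), add = add (R Quot I),
      smult = (\<lambda>r X. (I +>\<^bsub>R\<^esub> r) \<otimes>\<^bsub>R Quot I\<^esub> X)\<rparr>"

definition ideal_component ::
  "'v set \<Rightarrow> ('v, 'k::field) mpoly set \<Rightarrow> ('v \<Rightarrow> int) \<Rightarrow> ('v, 'k) mpoly set" where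
  "ideal_component V I a = I \<inter> poly_component V a"

definition quotient_component ::
  "'v set \<Rightarrow> ('v, 'k::field) mpoly set \<Rightarrow> ('v \<Rightarrow> int) \<Rightarrow> ('v, 'k) mpoly set set" where
  "quotient_component V I a = (\<lambda>p. I +>\<^bsub>poly_ring V\<^esub> p) ` poly_component V a"


section \<open>Stanley depth\<close>

definition stanley_set :: "(('v, 'k::field) mpoly, 'm) module \<Rightarrow> 'm \<Rightarrow> 'v set \<Rightarrow> 'm set" where
  "stanley_set M u Z = {v \<odot>\<^bsub>M\<^esub> u | v. v \<in> polys_in Z}"

text \<open>\<open>Gr\<close> is the family of homogeneous components of \<open>M\<close>. The cyclic module \<open>u K[Z]\<close> is required to be
  free on the generator \<open>u\<close>. The only other case in which it is free is \<open>u = 0\<close>; zero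
  summands are thus not admitted in a decomposition.\<close>

definition is_stanley_space ::
  "'v set \<Rightarrow> (('v \<Rightarrow> int) \<Rightarrow> 'm set) \<Rightarrow> (('v, 'k::field) mpoly, 'm) module \<Rightarrow> 'm \<Rightarrow> 'v set \<Rightarrow> bool"
  where
  "is_stanley_space V Gr M u Z \<longleftrightarrow>
     (\<exists>a. u \<in> Gr a) \<and> Z \<subseteq> V \<and>
     (\<forall>v\<in>polys_in Z. v \<odot>\<^bsub>M\<^esub> u = \<zero>\<^bsub>M\<^esub> \<longrightarrow> v = 0)"

text \<open>A decomposition is given by the finite set of pairs \<open>(u, Z)\<close> of its Stanley spaces.\<close>

definition stanley_decomposition ::
  "'v set \<Rightarrow> (('v \<Rightarrow> int) \<Rightarrow> 'm set) \<Rightarrow> (('v, 'k::field) mpoly, 'm) module \<Rightarrow>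
   ('m \<times> 'v set) set \<Rightarrow> bool" where
  "stanley_decomposition V Gr M D \<longleftrightarrow>
     finite D \<and>
     (\<forall>(u, Z)\<in>D. is_stanley_space V Gr M u Z) \<and>
     (\<forall>x\<in>carrier M. \<exists>!w. w \<in> (\<Pi>\<^sub>E (u, Z)\<in>D. stanley_set M u Z) \<and> x = (\<Oplus>\<^bsub>M\<^esub>d\<in>D. w d))"

text \<open>The infimum over the empty decomposition, which exists for the zero module only,
  is \<open>\<infinity>\<close>.\<close>

definition sdepth_decomposition :: "('m \<times> 'v set) set \<Rightarrow> enat" where
  "sdepth_decomposition D = (INF (u, Z)\<in>D. enat (card Z))"

definition sdepth ::
  "'v set \<Rightarrow> (('v \<Rightarrow> int) \<Rightarrow> 'm set) \<Rightarrow> (('v, 'k::field) mpoly, 'm) module \<Rightarrow> enat" where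
  "sdepth V Gr M = (SUP D\<in>{D. stanley_decomposition V Gr M D}. sdepth_decomposition D)"


section \<open>Depth\<close>

text \<open>The submodule \<open>(f\<^sub>1, \<dots>, f\<^sub>k)M\<close> for a list \<open>fs = [f\<^sub>1, \<dots>, f\<^sub>k]\<close>.\<close>

definition list_times_module :: "'r list \<Rightarrow> ('r, 'm) module \<Rightarrow> 'm set" where
  "list_times_module fs M =
     {\<Oplus>\<^bsub>M\<^esub>j\<in>{..<length fs}. fs ! j \<odot>\<^bsub>M\<^esub> w j | w. w \<in> {..<length fs} \<rightarrow> carrier M}"

text \<open>With \<open>N = (f\<^sub>1, \<dots>, f\<^sub>i)M\<close>, that \<open>f\<^sub>i\<^sub>+\<^sub>1\<close> is a nonzerodivisor on \<open>M / N\<close> is expressed by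
  \<open>f\<^sub>i\<^sub>+\<^sub>1 x \<in> N \<longrightarrow> x \<in> N\<close>.\<close>

definition regular_sequence :: "('r, 'm) module \<Rightarrow> 'r list \<Rightarrow> bool" where
  "regular_sequence M fs \<longleftrightarrow>
     (\<forall>i<length fs. \<forall>x\<in>carrier M.
        fs ! i \<odot>\<^bsub>M\<^esub> x \<in> list_times_module (take i fs) M \<longrightarrow>
        x \<in> list_times_module (take i fs) M) \<and>
     list_times_module fs M \<noteq> carrier M"

definition depth :: "'r set \<Rightarrow> ('r, 'm) module \<Rightarrow> enat" where
  "depth I M =
     (if carrier M = {\<zero>\<^bsub>M\<^esub>} then \<infinity>
      else SUP fs\<in>{fs. set fs \<subseteq> I \<and> regular_sequence M fs}. enat (length fs))"

definition irrelevant_ideal :: "'v set \<Rightarrow> ('v, 'k::field) mpoly set" where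
  "irrelevant_ideal V = Idl\<^bsub>poly_ring V\<^esub> (pvar ` V)"


section \<open>Cover ideals\<close>

definition cover_ideal :: "'v set \<Rightarrow> 'v set set \<Rightarrow> ('v, 'k::field) mpoly set" where
  "cover_ideal V E = carrier (poly_ring V) \<inter> (\<Inter>e\<in>E. Idl\<^bsub>poly_ring V\<^esub> (pvar ` e))"


section \<open>The module records define modules\<close>

lemma polys_in_add: "p \<in> polys_in V \<Longrightarrow> q \<in> polys_in V \<Longrightarrow> p + q \<in> polys_in V"
  using Poly_Mapping.keys_add[of p q] unfolding polys_in_def by blast

lemma polys_in_mult: "p \<in> polys_in V \<Longrightarrow> q \<in> polys_in V \<Longrightarrow> p * q \<in> polys_in V"
  for p :: "('v, 'k::field) mpoly"
proof -
  assume p: "p \<in> polys_in V" and q: "q \<in> polys_in V"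
  have "Poly_Mapping.keys m \<subseteq> V" if m: "m \<in> Poly_Mapping.keys (p * q)" for m
  proof -
    obtain a b where "m = a + b" "a \<in> Poly_Mapping.keys p" "b \<in> Poly_Mapping.keys q"
      using m keys_mult[of p q] by blast
    then show ?thesis using p q Poly_Mapping.keys_add[of a b] unfolding polys_in_def by blast
  qed
  then show ?thesis unfolding polys_in_def by blast
qed

lemma polys_in_zero_one: "0 \<in> polys_in V" "(1 :: ('v, 'k::field) mpoly) \<in> polys_in V"
  by (auto simp: polys_in_def)

lemma polys_in_uminus: "p \<in> polys_in V \<Longrightarrow> - p \<in> polys_in V" for p :: "('v, 'k::field) mpoly"
  by (simp add: polys_in_def)

lemma cring_poly_ring: "cring (poly_ring V :: ('v, 'k::field) mpoly ring)"
proof (rule cringI)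
  show "abelian_group (poly_ring V :: ('v, 'k::field) mpoly ring)"
  proof (rule abelian_groupI)
    fix x :: "('v, 'k::field) mpoly" assume "x \<in> carrier (poly_ring V)"
    then show "\<exists>y\<in>carrier (poly_ring V). y \<oplus>\<^bsub>poly_ring V\<^esub> x = \<zero>\<^bsub>poly_ring V\<^esub>"
      by (intro bexI[of _ "-x"]) (auto simp: poly_ring_def polys_in_uminus)
  qed (auto simp: poly_ring_def polys_in_add polys_in_zero_one add.assoc add.commute)
  show "comm_monoid (poly_ring V :: ('v, 'k::field) mpoly ring)"
    by (rule comm_monoidI) (auto simp: poly_ring_def polys_in_mult polys_in_zero_one mult.assoc mult.commute)
qed (auto simp: poly_ring_def algebra_simps)

lemma ideal_cover_ideal:
  assumes "simple_graph V E"
  shows "ideal (cover_ideal V E) (poly_ring V :: ('v, 'k::field) mpoly ring)"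
proof -
  interpret cring "poly_ring V :: ('v, 'k::field) mpoly ring" by (rule cring_poly_ring)
  have "pvar ` e \<subseteq> carrier (poly_ring V :: ('v, 'k::field) mpoly ring)" if "e \<in> E" for e
    using assms that by (fastforce simp: simple_graph_def poly_ring_def polys_in_def pvar_def)
  then have "ideal (\<Inter> (insert (carrier (poly_ring V)) ((\<lambda>e. Idl\<^bsub>poly_ring V\<^esub> (pvar ` e)) ` E))) (poly_ring V :: ('v, 'k::field) mpoly ring)"
    by (intro i_Intersect) (auto intro: oneideal genideal_ideal)
  then show ?thesis by (simp add: cover_ideal_def)
qed

lemma (in cring) module_ideal_module:
  assumes "ideal I R" shows "module R (ideal_module R I)"
proof -
  interpret ideal I R by fact
  have [simp]: "\<And>x. x \<in> I \<Longrightarrow> x \<in> carrier R" using a_subset by auto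
  show ?thesis
  proof (rule moduleI)
    show "abelian_group (ideal_module R I)"
    proof (rule abelian_groupI)
      fix x assume "x \<in> carrier (ideal_module R I)"
      then show "\<exists>y\<in>carrier (ideal_module R I). y \<oplus>\<^bsub>ideal_module R I\<^esub> x = \<zero>\<^bsub>ideal_module R I\<^esub>"
        by (intro bexI[of _ "\<ominus> x"]) (auto simp: ideal_module_def l_neg)
    qed (auto simp: ideal_module_def a_ac)
  qed (auto simp: ideal_module_def cring_axioms l_distr r_distr m_assoc I_l_closed is_cring)
qed

lemma (in cring) module_quotient_module:
  assumes "ideal I R" shows "module R (quotient_module R I)"
proof -
  interpret I: ideal I R by fact
  interpret Q: cring "R Quot I" by (rule I.quotient_is_cring[OF is_cring])
  have c: "I +> r \<in> carrier (R Quot I)" if "r \<in> carrier R" for r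
    using that by (auto simp: FactRing_def A_RCOSETS_def RCOSETS_def a_r_coset_def )
  have h: "(+>) I \<in> ring_hom R (R Quot I)" by (rule I.rcos_ring_hom)
  show ?thesis
  proof (rule moduleI)
    show "abelian_group (quotient_module R I)"
    proof (rule abelian_groupI)
      fix x assume "x \<in> carrier (quotient_module R I)"
      then show "\<exists>y\<in>carrier (quotient_module R I). y \<oplus>\<^bsub>quotient_module R I\<^esub> x = \<zero>\<^bsub>quotient_module R I\<^esub>"
        by (intro bexI[of _ "\<ominus>\<^bsub>R Quot I\<^esub> x"]) (auto simp: quotient_module_def Q.l_neg)
    qed (auto simp: quotient_module_def Q.a_ac)
  qed (use c in \<open>auto simp: quotient_module_def is_cring ring_hom_add[OF h] ring_hom_mult[OF h] ring_hom_one[OF h] Q.l_distr Q.r_distr Q.m_assoc\<close>)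
qed

end

theory Submission
  imports Defs "HOL-Library.Disjoint_Sets"
begin

text \<open>Everything is squarefree, so it is governed by up-sets of vertex sets. For a non-isolated vertex
  \<open>x\<close> one has \<open>J : x = J(G - x)\<close>, while the monomials of \<open>J\<close> not divisible by \<open>x\<close> are those of
  \<open>(\<Prod>y\<in>N(x). y) J(G - N[x])\<close>, and \<open>\<nu>\<^sub>o(G - N[x]) < \<nu>\<^sub>o(G)\<close> because an edge at \<open>x\<close> can be appended to an
  ordered matching of \<open>G - N[x]\<close>. Induction on the edges partitions the vertex covers, and the
  non-covers, into intervals \<open>[C, D]\<close> with \<open>D\<close> large; these are the Stanley spaces \<open>x\<^sup>C K[D]\<close>.
  The same recursion filters \<open>S/J\<close> with factors \<open>K[Z]\<close> for large \<open>Z\<close>, and the elementary symmetric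
  polynomials \<open>e\<^sub>1, \<dots>, e\<^sub>d\<close> in all variables are regular on every \<open>K[Z]\<close> with \<open>|Z| \<ge> d\<close>, over any
  field; hence they are regular on \<open>S/J\<close>.\<close>

text \<open>The depth lemma is therefore replaced by a statement about one sequence that is regular
  on both outer terms; the elementary symmetric polynomials fit because they depend on
  \<open>V\<close> alone and not on the factor. The recursion leaves the class of cover ideals:
  \<open>(J, x)\<close> is \<open>(x)\<close> plus the product of \<open>N(x)\<close> times a
  smaller cover ideal. So the induction carries a set \<open>W\<close> of variables already set to
  zero, and the product is peeled off one neighbour \<open>y\<close> at a time. Peeling produces
  factors in which both \<open>x\<close> and \<open>y\<close> vanish: two variables are lost where
  \<open>\<nu>\<^sub>o\<close> is only known to drop by one. This is the origin of the
  \<open>- 1\<close> for \<open>S/J\<close>; a single edge attains it, with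
  \<open>S/J = K[x, y]/(x, y)\<close>. The partition of the covers has no such loss, since demanding
  \<open>N(x) \<subseteq> A\<close> raises only the bottoms of the intervals.\<close>

section \<open>Ordered matchings of induced subgraphs\<close>

text \<open>This is \<open>G - W\<close> on the unchanged vertex set: deleted vertices stay as
  isolated ones, so \<open>V\<close> and \<open>card V\<close> are constant along the induction and
  only \<open>E\<close> shrinks.\<close>

definition edges_avoiding :: "'v set set \<Rightarrow> 'v set \<Rightarrow> 'v set set" where
  "edges_avoiding E W = {e \<in> E. e \<inter> W = {}}"

definition nbhd :: "'v set set \<Rightarrow> 'v \<Rightarrow> 'v set" where
  "nbhd E x = {y. {x, y} \<in> E}"

text \<open>\<open>C\<close> may contain elements outside \<open>V\<close>, which makes the family
  an up-set of the whole type; the restriction to \<open>V\<close> is left to \<open>Pow V\<close>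
  and \<open>mon_span V\<close>.\<close>

definition vertex_covers :: "'v set set \<Rightarrow> 'v set set" where
  "vertex_covers E = {C. \<forall>e\<in>E. e \<inter> C \<noteq> {}}"

lemma simple_graph_edges_avoiding:
  "simple_graph V E \<Longrightarrow> simple_graph V (edges_avoiding E W)"
  by (auto simp: simple_graph_def edges_avoiding_def)

lemma simple_graph_finite_edges: "simple_graph V E \<Longrightarrow> finite E"
  by (rule finite_subset[of _ "Pow V"]) (auto simp: simple_graph_def)

lemma simple_graph_edgeD:
  assumes "simple_graph V E" "{x, y} \<in> E"
  shows "x \<in> V" "y \<in> V" "x \<noteq> y"
proof -
  have "{x, y} \<subseteq> V \<and> card {x, y} = 2" using assms unfolding simple_graph_def by blast
  then show "x \<in> V" "y \<in> V" "x \<noteq> y" by (auto simp: card_insert_if split: if_splits)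
qed

lemma simple_graph_edgeE:
  assumes "simple_graph V E" "e \<in> E"
  obtains x y where "e = {x, y}"
  using assms by (auto simp: simple_graph_def card_2_iff)

lemma ordered_matchingI:
  assumes "1 \<le> r" "\<And>i. i \<in> {1..r} \<Longrightarrow> {a i, b i} \<in> E"
    and "\<And>i j. i \<in> {1..r} \<Longrightarrow> j \<in> {1..r} \<Longrightarrow> i \<noteq> j \<Longrightarrow> {a i, b i} \<inter> {a j, b j} = {}"
    and "indep (a ` {1..r}) E"
    and "\<And>i j. i \<in> {1..r} \<Longrightarrow> j \<in> {1..r} \<Longrightarrow> {a i, b j} \<in> E \<Longrightarrow> i \<le> j"
  shows "ordered_matching E r a b"
  unfolding ordered_matching_def using assms(1,4)
  by (intro conjI ballI impI) (assumption | rule assms(2,3,5); assumption)+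

lemma ordered_matchingD:
  assumes "ordered_matching E r a b"
  shows "1 \<le> r" "\<And>i. i \<in> {1..r} \<Longrightarrow> {a i, b i} \<in> E"
    and "\<And>i j. i \<in> {1..r} \<Longrightarrow> j \<in> {1..r} \<Longrightarrow> i \<noteq> j \<Longrightarrow> {a i, b i} \<inter> {a j, b j} = {}"
    and "indep (a ` {1..r}) E"
    and "\<And>i j. i \<in> {1..r} \<Longrightarrow> j \<in> {1..r} \<Longrightarrow> {a i, b j} \<in> E \<Longrightarrow> i \<le> j"
proof -
  have c: "1 \<le> r" "\<forall>i\<in>{1..r}. {a i, b i} \<in> E"
    "\<forall>i\<in>{1..r}. \<forall>j\<in>{1..r}. i \<noteq> j \<longrightarrow> {a i, b i} \<inter> {a j, b j} = {}"
    "indep (a ` {1..r}) E" "\<forall>i\<in>{1..r}. \<forall>j\<in>{1..r}. {a i, b j} \<in> E \<longrightarrow> i \<le> j"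
    using assms unfolding ordered_matching_def by - (elim conjE, assumption)+
  show "1 \<le> r" "indep (a ` {1..r}) E" by (rule c)+
  show "{a i, b i} \<in> E" if "i \<in> {1..r}" for i
    using c(2) that by (rule bspec)
  show "{a i, b i} \<inter> {a j, b j} = {}" if "i \<in> {1..r}" "j \<in> {1..r}" "i \<noteq> j" for i j
    by (rule c(3)[THEN bspec, THEN bspec, THEN mp, OF that])
  show "i \<le> j" if "i \<in> {1..r}" "j \<in> {1..r}" "{a i, b j} \<in> E" for i j
    by (rule c(5)[THEN bspec, THEN bspec, THEN mp, OF that])
qed

text \<open>Conditions (1) and (2) forbid edges, so they could fail in a larger graph. They persist
  because only vertices were deleted: an edge of \<open>E\<close> between two endpoints of the
  matching avoids \<open>W\<close> and is already in the subgraph.\<close>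

lemma ordered_matching_edges_avoiding:
  assumes "ordered_matching (edges_avoiding E W) r a b"
  shows "ordered_matching E r a b"
proof (rule ordered_matchingI)
  note D = ordered_matchingD[OF assms]
  have W: "a i \<notin> W" "b i \<notin> W" if "i \<in> {1..r}" for i
    using D(2)[OF that] by (auto simp: edges_avoiding_def)
  have E: "{u, v} \<in> edges_avoiding E W" if "u \<notin> W" "v \<notin> W" "{u, v} \<in> E" for u v
    using that by (simp add: edges_avoiding_def)
  show "indep (a ` {1..r}) E"
    using D(4) W(1) E unfolding indep_def by (metis imageE)
  show "i \<le> j" if "i \<in> {1..r}" "j \<in> {1..r}" "{a i, b j} \<in> E" for i j
    by (rule D(5)[OF that(1,2) E[OF W(1)[OF that(1)] W(2)[OF that(2)] that(3)]])
  show "{a i, b i} \<in> E" if "i \<in> {1..r}" for i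
    using D(2)[OF that] by (simp add: edges_avoiding_def)
qed (rule ordered_matchingD[OF assms]; assumption)+

text \<open>The \<open>a i\<close> are distinct vertices. The bound makes the set under
  \<open>Max\<close> finite, and later it excludes truncation in
  \<open>card V - ordered_matching_number E\<close>.\<close>

lemma ordered_matching_le_card:
  assumes G: "simple_graph V E" and m: "ordered_matching E r a b"
  shows "r \<le> card V"
proof -
  note D = ordered_matchingD[OF m]
  have "inj_on a {1..r}"
    using D(3) by (intro inj_onI) (metis IntI empty_iff insertI1)
  moreover have "a ` {1..r} \<subseteq> V"
    using simple_graph_edgeD(1)[OF G D(2)] by (intro image_subsetI)
  ultimately show ?thesis
    using card_inj_on_le[of a "{1..r}" V] G by (simp add: simple_graph_def)
qed

lemma ordered_matching_edge:
  assumes "simple_graph V E" "{x, y} \<in> E"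
  shows "ordered_matching E 1 (\<lambda>_. x) (\<lambda>_. y)"
  using assms(2) by (intro ordered_matchingI) (simp_all add: indep_def)

text \<open>The new edge comes last, with \<open>x\<close> in the role of \<open>a\<close>. No old
  endpoint is \<open>x\<close> or adjacent to \<open>x\<close>, so independence persists and no
  \<open>{x, b j}\<close> is an edge; edges \<open>{a i, y}\<close> are permitted, as
  \<open>y\<close> has the last index.\<close>

lemma ordered_matching_append:
  assumes G: "simple_graph V E" and e: "{x, y} \<in> E"
    and m: "ordered_matching (edges_avoiding E (insert x (nbhd E x))) r a b"
  shows "ordered_matching E (Suc r) (a(Suc r := x)) (b(Suc r := y))"
proof -
  have av: "a i \<noteq> x" "b i \<noteq> x" "{x, a i} \<notin> E" "{x, b i} \<notin> E" if "i \<in> {1..r}" for i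
  proof -
    have "{a i, b i} \<in> edges_avoiding E (insert x (nbhd E x))"
      by (rule ordered_matchingD(2)[OF m that])
    then show "a i \<noteq> x" "b i \<noteq> x" "{x, a i} \<notin> E" "{x, b i} \<notin> E"
      by (auto simp: edges_avoiding_def nbhd_def)
  qed
  then have avy: "a i \<noteq> y" "b i \<noteq> y" if "i \<in> {1..r}" for i
    using that e by blast+
  have S: "{1..Suc r} = insert (Suc r) {1..r}" by auto
  note m' = ordered_matchingD(2,3,5)[OF ordered_matching_edges_avoiding[OF m]]
  have 1: "\<forall>i\<in>{1..Suc r}. {(a(Suc r := x)) i, (b(Suc r := y)) i} \<in> E"
    unfolding S using m'(1) e by auto
  have 2: "{(a(Suc r := x)) i, (b(Suc r := y)) i} \<inter> {(a(Suc r := x)) j, (b(Suc r := y)) j} = {}"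
    if ij: "i \<in> {1..Suc r}" "j \<in> {1..Suc r}" "i \<noteq> j" for i j
  proof -
    have *: "{a i, b i} \<inter> {x, y} = {}" if "i \<in> {1..r}" for i
      using av(1,2)[OF that] avy[OF that] by auto
    consider "i = Suc r" "j \<in> {1..r}" | "j = Suc r" "i \<in> {1..r}" | "i \<in> {1..r}" "j \<in> {1..r}"
        using ij by fastforce
    then show ?thesis
      using *[of i] *[of j] m'(2)[of i j] ij by cases auto
  qed
  have im: "(a(Suc r := x)) ` {1..Suc r} = insert x (a ` {1..r})"
    by (auto simp: S)
  have "indep (a ` {1..r}) E"
    by (rule ordered_matchingD(4)[OF ordered_matching_edges_avoiding[OF m]])
  then have 3: "indep ((a(Suc r := x)) ` {1..Suc r}) E"
    using av(3) unfolding im indep_def by (auto simp: insert_commute)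
  have 4: "i \<le> j" if rng: "i \<in> {1..Suc r}" "j \<in> {1..Suc r}"
    and ij: "{(a(Suc r := x)) i, (b(Suc r := y)) j} \<in> E" for i j
  proof -
    consider "j = Suc r" | "i = Suc r" "j \<in> {1..r}" | "i \<in> {1..r}" "j \<in> {1..r}"
      using rng by fastforce
    then show ?thesis
    proof cases
      case 3
      then show ?thesis using m'(3)[of i j] ij by simp
    qed (use rng ij av(4) in auto)
  qed
  show ?thesis
    by (rule ordered_matchingI[OF _ bspec[OF 1] 2 3 4]) simp_all
qed

section \<open>The ordered matching number and its behaviour under vertex deletion\<close>

context
  fixes V :: "'v set" and E :: "'v set set"
  assumes G: "simple_graph V E"
begin

lemma finite_ordered_matchings: "finite {r. \<exists>a b. ordered_matching E r a b}"
  by (rule finite_subset[of _ "{..card V}"]) (use ordered_matching_le_card[OF G] in auto)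

lemma ordered_matching_le_number:
  assumes "ordered_matching E r a b"
  shows "r \<le> ordered_matching_number E"
proof -
  have "E \<noteq> {}" using ordered_matchingD(1,2)[OF assms] by force
  then show ?thesis
    using assms Max_ge[OF finite_ordered_matchings] by (auto simp: ordered_matching_number_def)
qed

lemma ordered_matching_number_attained:
  assumes "E \<noteq> {}"
  obtains a b where "ordered_matching E (ordered_matching_number E) a b"
proof -
  obtain x y where "{x, y} \<in> E"
    using assms simple_graph_edgeE[OF G] by (metis all_not_in_conv)
  then have "{r. \<exists>a b. ordered_matching E r a b} \<noteq> {}"
    using ordered_matching_edge[OF G] by blast
  from Max_in[OF finite_ordered_matchings this] show ?thesis
    using assms that by (auto simp: ordered_matching_number_def)
qed

end

lemma ordered_matching_number_edges_avoiding_le: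
  assumes "simple_graph V E"
  shows "ordered_matching_number (edges_avoiding E W) \<le> ordered_matching_number E"
proof (cases "edges_avoiding E W = {}")
  case False
  obtain a b where "ordered_matching (edges_avoiding E W)
      (ordered_matching_number (edges_avoiding E W)) a b"
    by (rule ordered_matching_number_attained[OF simple_graph_edges_avoiding[OF assms] False])
  then show ?thesis
    using ordered_matching_le_number[OF assms ordered_matching_edges_avoiding] by blast
qed (simp add: ordered_matching_number_def)

lemma ordered_matching_number_nbhd_less:
  assumes G: "simple_graph V E" and e: "{x, y} \<in> E"
  shows "ordered_matching_number (edges_avoiding E (insert x (nbhd E x))) < ordered_matching_number E"
proof (cases "edges_avoiding E (insert x (nbhd E x)) = {}")
  case True
  then show ?thesis
    using ordered_matching_le_number[OF G ordered_matching_edge[OF G e]]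
    by (simp add: ordered_matching_number_def)
next
  case False
  obtain a b where "ordered_matching (edges_avoiding E (insert x (nbhd E x)))
      (ordered_matching_number (edges_avoiding E (insert x (nbhd E x)))) a b"
    by (rule ordered_matching_number_attained[OF simple_graph_edges_avoiding[OF G] False])
  then show ?thesis
    using ordered_matching_le_number[OF G ordered_matching_append[OF G e]] by (simp add: Suc_le_eq)
qed

text \<open>A cover missing \<open>x\<close> must contain all of \<open>N(x)\<close>; this already
  covers every edge that meets \<open>N[x]\<close>, and what remains are the edges of
  \<open>G - N[x]\<close>.\<close>

lemma vertex_covers_avoiding_iff:
  assumes G: "simple_graph V E" and x: "x \<notin> A"
  shows "A \<in> vertex_covers E \<longleftrightarrow>
    nbhd E x \<subseteq> A \<and> A \<in> vertex_covers (edges_avoiding E (insert x (nbhd E x)))"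
proof (intro iffI conjI)
  assume A: "A \<in> vertex_covers E"
  then show "nbhd E x \<subseteq> A" using x by (auto simp: vertex_covers_def nbhd_def)
  show "A \<in> vertex_covers (edges_avoiding E (insert x (nbhd E x)))"
    using A by (auto simp: vertex_covers_def edges_avoiding_def)
next
  assume A: "nbhd E x \<subseteq> A \<and> A \<in> vertex_covers (edges_avoiding E (insert x (nbhd E x)))"
  have "e \<inter> A \<noteq> {}" if "e \<in> E" for e
  proof (cases "e \<in> edges_avoiding E (insert x (nbhd E x))")
    case True
    then show ?thesis using A by (auto simp: vertex_covers_def)
  next
    case False
    obtain u v where "e = {u, v}" by (rule simple_graph_edgeE[OF G \<open>e \<in> E\<close>])
    then show ?thesis
      using False that A by (auto simp: edges_avoiding_def nbhd_def insert_commute)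
  qed
  then show "A \<in> vertex_covers E" by (simp add: vertex_covers_def)
qed

section \<open>Interval partitions of families of vertex sets\<close>

definition has_partition :: "'v set \<Rightarrow> nat \<Rightarrow> 'v set set \<Rightarrow> bool" where
  "has_partition V d \<F> \<longleftrightarrow>
     (\<exists>P. (\<forall>p\<in>P. fst p \<subseteq> snd p \<and> snd p \<subseteq> V \<and> d \<le> card (snd p)) \<and>
          (\<Union>p\<in>P. {fst p..snd p}) = \<F> \<and> disjoint_family_on (\<lambda>p. {fst p..snd p}) P)"

lemma has_partitionI:
  assumes "\<And>p. p \<in> P \<Longrightarrow> fst p \<subseteq> snd p" "\<And>p. p \<in> P \<Longrightarrow> snd p \<subseteq> V"
    and "\<And>p. p \<in> P \<Longrightarrow> d \<le> card (snd p)" "(\<Union>p\<in>P. {fst p..snd p}) = \<F>"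
    and "\<And>p q A. p \<in> P \<Longrightarrow> q \<in> P \<Longrightarrow> fst p \<subseteq> A \<Longrightarrow> A \<subseteq> snd p \<Longrightarrow> fst q \<subseteq> A \<Longrightarrow> A \<subseteq> snd q \<Longrightarrow> p = q"
  shows "has_partition V d \<F>"
proof -
  have "disjoint_family_on (\<lambda>p. {fst p..snd p}) P"
    using assms(5) unfolding disjoint_family_on_def by (meson atLeastAtMost_iff disjoint_iff)
  then show ?thesis
    unfolding has_partition_def using assms(1-4) by (intro exI[of _ P]) blast
qed

lemma has_partitionE:
  assumes "has_partition V d \<F>"
  obtains P where "\<And>p. p \<in> P \<Longrightarrow> fst p \<subseteq> snd p" "\<And>p. p \<in> P \<Longrightarrow> snd p \<subseteq> V"
    and "\<And>p. p \<in> P \<Longrightarrow> d \<le> card (snd p)" "(\<Union>p\<in>P. {fst p..snd p}) = \<F>"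
    and "\<And>p q A. p \<in> P \<Longrightarrow> q \<in> P \<Longrightarrow> fst p \<subseteq> A \<Longrightarrow> A \<subseteq> snd p \<Longrightarrow> fst q \<subseteq> A \<Longrightarrow> A \<subseteq> snd q \<Longrightarrow> p = q"
proof -
  obtain P where P: "\<forall>p\<in>P. fst p \<subseteq> snd p \<and> snd p \<subseteq> V \<and> d \<le> card (snd p)"
    "(\<Union>p\<in>P. {fst p..snd p}) = \<F>" "disjoint_family_on (\<lambda>p. {fst p..snd p}) P"
    using assms unfolding has_partition_def by (elim exE conjE) (rule that)
  have "p = q" if "p \<in> P" "q \<in> P" "fst p \<subseteq> A" "A \<subseteq> snd p" "fst q \<subseteq> A" "A \<subseteq> snd q" for p q A
    using disjoint_family_onD[OF P(3) that(1,2)] that(3-6)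
    by (metis IntI atLeastAtMost_iff empty_iff)
  then show ?thesis
    using P(1,2) by (intro that[of P]) simp_all
qed

lemma has_partition_mono:
  assumes "has_partition V d \<F>" "d' \<le> d"
  shows "has_partition V d' \<F>"
proof -
  obtain P where P: "\<And>p. p \<in> P \<Longrightarrow> fst p \<subseteq> snd p" "\<And>p. p \<in> P \<Longrightarrow> snd p \<subseteq> V"
    "\<And>p. p \<in> P \<Longrightarrow> d \<le> card (snd p)" "(\<Union>p\<in>P. {fst p..snd p}) = \<F>"
    "\<And>p q A. p \<in> P \<Longrightarrow> q \<in> P \<Longrightarrow> fst p \<subseteq> A \<Longrightarrow> A \<subseteq> snd p \<Longrightarrow> fst q \<subseteq> A \<Longrightarrow> A \<subseteq> snd q \<Longrightarrow> p = q"
    using assms(1) by (rule has_partitionE) (rule that)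
  show ?thesis
    by (rule has_partitionI[OF P(1,2) order_trans[OF assms(2) P(3)] P(4,5)])
qed

lemma has_partition_interval:
  "C \<subseteq> D \<Longrightarrow> D \<subseteq> V \<Longrightarrow> d \<le> card D \<Longrightarrow> has_partition V d {C..D}"
  by (rule has_partitionI[of "{(C, D)}"]) auto

lemma has_partition_empty: "has_partition V d {}"
  by (rule has_partitionI[of "{}"]) auto

lemma has_partition_Un:
  assumes "has_partition V d \<F>" "has_partition V d \<G>" and disj: "\<F> \<inter> \<G> = {}"
  shows "has_partition V d (\<F> \<union> \<G>)"
proof -
  obtain P where P: "\<And>p. p \<in> P \<Longrightarrow> fst p \<subseteq> snd p" "\<And>p. p \<in> P \<Longrightarrow> snd p \<subseteq> V"
    "\<And>p. p \<in> P \<Longrightarrow> d \<le> card (snd p)" "(\<Union>p\<in>P. {fst p..snd p}) = \<F>"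
    "\<And>p q A. p \<in> P \<Longrightarrow> q \<in> P \<Longrightarrow> fst p \<subseteq> A \<Longrightarrow> A \<subseteq> snd p \<Longrightarrow> fst q \<subseteq> A \<Longrightarrow> A \<subseteq> snd q \<Longrightarrow> p = q"
    using assms(1) by (rule has_partitionE) (rule that)
  obtain Q where Q: "\<And>p. p \<in> Q \<Longrightarrow> fst p \<subseteq> snd p" "\<And>p. p \<in> Q \<Longrightarrow> snd p \<subseteq> V"
    "\<And>p. p \<in> Q \<Longrightarrow> d \<le> card (snd p)" "(\<Union>p\<in>Q. {fst p..snd p}) = \<G>"
    "\<And>p q A. p \<in> Q \<Longrightarrow> q \<in> Q \<Longrightarrow> fst p \<subseteq> A \<Longrightarrow> A \<subseteq> snd p \<Longrightarrow> fst q \<subseteq> A \<Longrightarrow> A \<subseteq> snd q \<Longrightarrow> p = q"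
    using assms(2) by (rule has_partitionE) (rule that)
  have PQ: False if "p \<in> P" "q \<in> Q" "fst p \<subseteq> A" "A \<subseteq> snd p" "fst q \<subseteq> A" "A \<subseteq> snd q" for p q A
  proof -
    have "A \<in> \<F>" "A \<in> \<G>"
      unfolding P(4)[symmetric] Q(4)[symmetric] using that by (meson UN_I atLeastAtMost_iff)+
    then show False using disj by blast
  qed
  show ?thesis
  proof (rule has_partitionI[of "P \<union> Q"])
    show "(\<Union>p\<in>P \<union> Q. {fst p..snd p}) = \<F> \<union> \<G>"
      using P(4) Q(4) by (simp add: UN_Un)
    show "p = q" if "p \<in> P \<union> Q" "q \<in> P \<union> Q" "fst p \<subseteq> A" "A \<subseteq> snd p" "fst q \<subseteq> A" "A \<subseteq> snd q"
      for p q A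
      using that(1,2) P(5)[OF _ _ that(3-6)] Q(5)[OF _ _ that(3-6)]
        PQ[OF _ _ that(3-6)] PQ[OF _ _ that(5,6,3,4)] by blast
  qed (use P(1-3) Q(1-3) in blast)+
qed

text \<open>An interval \<open>[C, D]\<close> meets the sets above \<open>N\<close> in
  \<open>[C \<union> N, D]\<close> if \<open>N \<subseteq> D\<close>, and not at all otherwise. The
  tops are unchanged, so \<open>d\<close> is kept.\<close>

lemma has_partition_superset:
  assumes "has_partition V d \<F>"
  shows "has_partition V d {A \<in> \<F>. N \<subseteq> A}"
proof -
  obtain P where P: "\<And>p. p \<in> P \<Longrightarrow> fst p \<subseteq> snd p" "\<And>p. p \<in> P \<Longrightarrow> snd p \<subseteq> V"
    "\<And>p. p \<in> P \<Longrightarrow> d \<le> card (snd p)" "(\<Union>p\<in>P. {fst p..snd p}) = \<F>"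
    "\<And>p q A. p \<in> P \<Longrightarrow> q \<in> P \<Longrightarrow> fst p \<subseteq> A \<Longrightarrow> A \<subseteq> snd p \<Longrightarrow> fst q \<subseteq> A \<Longrightarrow> A \<subseteq> snd q \<Longrightarrow> p = q"
    using assms by (rule has_partitionE) (rule that)
  define Q where "Q = (\<lambda>p. (fst p \<union> N, snd p)) ` {p \<in> P. N \<subseteq> snd p}"
  have QE: "\<exists>p'. p' \<in> P \<and> N \<subseteq> snd p' \<and> p = (fst p' \<union> N, snd p')" if "p \<in> Q" for p
    using that by (auto simp: Q_def)
  show ?thesis
  proof (rule has_partitionI[of Q])
    have "A \<in> (\<Union>p\<in>Q. {fst p..snd p}) \<longleftrightarrow> A \<in> (\<Union>p\<in>P. {fst p..snd p}) \<and> N \<subseteq> A" for A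
      by (simp add: Q_def Bex_def) blast
    then show "(\<Union>p\<in>Q. {fst p..snd p}) = {A \<in> \<F>. N \<subseteq> A}"
      unfolding P(4) by blast
    show "p = q" if pq: "p \<in> Q" "q \<in> Q" and A: "fst p \<subseteq> A" "A \<subseteq> snd p" "fst q \<subseteq> A" "A \<subseteq> snd q" for p q A
    proof -
      obtain p' q' where "p' \<in> P" "p = (fst p' \<union> N, snd p')" "q' \<in> P" "q = (fst q' \<union> N, snd q')"
        using QE pq by blast
      then show ?thesis using P(5)[of p' q' A] A by simp
    qed
    fix p assume "p \<in> Q"
    then obtain p' where p': "p' \<in> P" "N \<subseteq> snd p'" "p = (fst p' \<union> N, snd p')"
      using QE by blast
    then show "fst p \<subseteq> snd p" "snd p \<subseteq> V" "d \<le> card (snd p)"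
      using P(1-3)[OF p'(1)] by auto
  qed
qed

text \<open>Here \<open>[C, D]\<close> becomes \<open>[C, D - {x}]\<close>, or disappears if
  \<open>x \<in> C\<close>; a top loses at most one element, which costs one unit of
  \<open>d\<close>.\<close>

lemma has_partition_avoid:
  assumes "has_partition V (Suc d) \<F>"
  shows "has_partition V d {A \<in> \<F>. x \<notin> A}"
proof -
  obtain P where P: "\<And>p. p \<in> P \<Longrightarrow> fst p \<subseteq> snd p" "\<And>p. p \<in> P \<Longrightarrow> snd p \<subseteq> V"
    "\<And>p. p \<in> P \<Longrightarrow> Suc d \<le> card (snd p)" "(\<Union>p\<in>P. {fst p..snd p}) = \<F>"
    "\<And>p q A. p \<in> P \<Longrightarrow> q \<in> P \<Longrightarrow> fst p \<subseteq> A \<Longrightarrow> A \<subseteq> snd p \<Longrightarrow> fst q \<subseteq> A \<Longrightarrow> A \<subseteq> snd q \<Longrightarrow> p = q"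
    using assms by (rule has_partitionE) (rule that)
  define Q where "Q = (\<lambda>p. (fst p, snd p - {x})) ` {p \<in> P. x \<notin> fst p}"
  have QE: "\<exists>p'. p' \<in> P \<and> x \<notin> fst p' \<and> p = (fst p', snd p' - {x})" if "p \<in> Q" for p
    using that by (auto simp: Q_def)
  show ?thesis
  proof (rule has_partitionI[of Q])
    have "A \<in> (\<Union>p\<in>Q. {fst p..snd p}) \<longleftrightarrow> A \<in> (\<Union>p\<in>P. {fst p..snd p}) \<and> x \<notin> A" for A
      by (simp add: Q_def Bex_def) blast
    then show "(\<Union>p\<in>Q. {fst p..snd p}) = {A \<in> \<F>. x \<notin> A}"
      unfolding P(4) by blast
    show "p = q" if pq: "p \<in> Q" "q \<in> Q" and A: "fst p \<subseteq> A" "A \<subseteq> snd p" "fst q \<subseteq> A" "A \<subseteq> snd q" for p q A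
    proof -
      obtain p' q' where "p' \<in> P" "p = (fst p', snd p' - {x})" "q' \<in> P" "q = (fst q', snd q' - {x})"
        using QE pq by blast
      then show ?thesis using P(5)[of p' q' A] A by auto
    qed
    fix p assume "p \<in> Q"
    then obtain p' where p': "p' \<in> P" "x \<notin> fst p'" "p = (fst p', snd p' - {x})"
      using QE by blast
    then show "fst p \<subseteq> snd p" "snd p \<subseteq> V" "d \<le> card (snd p)"
      using P(1-3)[OF p'(1)] by (auto simp: card_Diff_singleton_if)
  qed
qed

text \<open>Covers containing \<open>x\<close> come from \<open>G - x\<close> with \<open>d\<close>
  kept. Covers avoiding \<open>x\<close> come from \<open>G - N[x]\<close> at the cost of one unit,
  which the strict drop of the ordered matching number pays for. Without edges the single interval
  from \<open>{}\<close> to \<open>V\<close> suffices, hence no \<open>- 1\<close>.\<close>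

lemma has_partition_covers:
  assumes "simple_graph V E"
  shows "has_partition V (card V - ordered_matching_number E) (Pow V \<inter> vertex_covers E)"
  using assms
proof (induction "card E" arbitrary: E rule: less_induct)
  case less
  note G = less.prems
  let ?\<nu> = "ordered_matching_number"
  show ?case
  proof (cases "E = {}")
    case True
    moreover have "Pow V = {{}..V}" by auto
    ultimately show ?thesis
      using has_partition_interval[of "{}" V V "card V"]
      by (simp add: vertex_covers_def ordered_matching_number_def)
  next
    case False
    then obtain x y where e: "{x, y} \<in> E"
      using simple_graph_edgeE[OF G] by (metis all_not_in_conv)
    have smaller: "card (edges_avoiding E W) < card E" if "x \<in> W" for W
    proof (rule psubset_card_mono[OF simple_graph_finite_edges[OF G]])
      have "{x, y} \<notin> edges_avoiding E W" using that by (auto simp: edges_avoiding_def)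
      moreover have "edges_avoiding E W \<subseteq> E" by (auto simp: edges_avoiding_def)
      ultimately show "edges_avoiding E W \<subset> E" using e by blast
    qed
    let ?E1 = "edges_avoiding E {x}" and ?E2 = "edges_avoiding E (insert x (nbhd E x))"
    have "has_partition V (card V - ?\<nu> E) (Pow V \<inter> vertex_covers ?E1)"
      using less.hyps[OF smaller simple_graph_edges_avoiding[OF G], of "{x}"]
        ordered_matching_number_edges_avoiding_le[OF G, of "{x}"]
      by (auto intro: has_partition_mono)
    from has_partition_superset[OF this, of "{x}"]
    have 1: "has_partition V (card V - ?\<nu> E) {A \<in> Pow V \<inter> vertex_covers E. x \<in> A}"
      by (rule back_subst[of "has_partition V _"]) (auto simp: vertex_covers_def edges_avoiding_def)
    have \<nu>: "?\<nu> ?E2 < ?\<nu> E" by (rule ordered_matching_number_nbhd_less[OF G e])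
    \<comment> \<open>Excludes truncation: if \<open>?\<nu> E\<close> exceeded
      \<open>card V\<close>, the drop of \<open>?\<nu>\<close> would not provide the extra
      unit.\<close>
    have "?\<nu> E \<le> card V"
      using ordered_matching_number_attained[OF G False] ordered_matching_le_card[OF G] by metis
    then have "has_partition V (Suc (card V - ?\<nu> E)) (Pow V \<inter> vertex_covers ?E2)"
      using less.hyps[OF smaller simple_graph_edges_avoiding[OF G], of "insert x (nbhd E x)"] \<nu>
      by (auto intro: has_partition_mono)
    from has_partition_avoid[OF has_partition_superset[OF this, of "nbhd E x"], of x]
    have 2: "has_partition V (card V - ?\<nu> E) {A \<in> Pow V \<inter> vertex_covers E. x \<notin> A}"
      by (rule back_subst[of "has_partition V _"]) (use vertex_covers_avoiding_iff[OF G] in blast)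
    show ?thesis
      using has_partition_Un[OF 1 2] by (rule back_subst[of "has_partition V _"]) auto
  qed
qed

section \<open>Families obtained by successive splitting\<close>

definition upset :: "'v set set \<Rightarrow> bool" where
  "upset \<C> \<longleftrightarrow> (\<forall>C\<in>\<C>. \<forall>D. C \<subseteq> D \<longrightarrow> D \<in> \<C>)"

lemma upset_Un: "upset \<C> \<Longrightarrow> upset \<D> \<Longrightarrow> upset (\<C> \<union> \<D>)"
  unfolding upset_def by blast

lemma upset_vertex_covers: "upset {C \<in> vertex_covers E. Y \<subseteq> C}"
  unfolding upset_def vertex_covers_def by blast

text \<open>If \<open>I\<close> is the ideal of the monomials with support in the up-set
  \<open>\<C>\<close>, then \<open>colon_fam\<close>, \<open>extend_fam\<close> and
  \<open>prime_fam W\<close> describe \<open>I : x\<close>, \<open>I + (x)\<close> and the prime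
  generated by the variables of \<open>W\<close> (\<open>colon_mon_span\<close>,
  \<open>adjoin_mon_span\<close>, \<open>genideal_pvar\<close>).\<close>

definition colon_fam :: "'v set set \<Rightarrow> 'v \<Rightarrow> 'v set set" where
  "colon_fam \<C> x = {C. insert x C \<in> \<C>}"

definition extend_fam :: "'v set set \<Rightarrow> 'v \<Rightarrow> 'v set set" where
  "extend_fam \<C> x = {C. x \<in> C \<or> C \<in> \<C>}"

definition prime_fam :: "'v set \<Rightarrow> 'v set set" where
  "prime_fam W = {C. C \<inter> W \<noteq> {}}"

lemma upset_prime_fam: "upset (prime_fam W)"
  unfolding upset_def prime_fam_def by blast

text \<open>A derivation certifies that \<open>S/I\<close> is built from factors
  \<open>K[V - W]\<close> with at least \<open>d\<close> variables: each split is the sequence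
  \<open>0 -> S/(I : x) -> S/I -> S/(I, x) -> 0\<close>. Both bounds for \<open>S/J\<close> are read
  off the same derivation. The unit ideal is a leaf for every \<open>d\<close>, its quotient being
  zero.\<close>

inductive split_fam :: "'v set \<Rightarrow> nat \<Rightarrow> 'v set set \<Rightarrow> bool" for V :: "'v set" and d :: nat where
  unit: "split_fam V d UNIV"
| prime: "W \<subseteq> V \<Longrightarrow> d \<le> card (V - W) \<Longrightarrow> split_fam V d (prime_fam W)"
| split: "x \<in> V \<Longrightarrow> upset \<C> \<Longrightarrow> split_fam V d (colon_fam \<C> x) \<Longrightarrow>
    split_fam V d (extend_fam \<C> x) \<Longrightarrow> split_fam V d \<C>"

lemma split_fam_mono: "split_fam V d \<C> \<Longrightarrow> d' \<le> d \<Longrightarrow> split_fam V d' \<C>"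
proof (induction rule: split_fam.induct)
  case (split x \<C>)
  then show ?case by (intro split_fam.split[of x V \<C> d']) simp_all
qed (auto intro: split_fam.unit split_fam.prime)

text \<open>For \<open>x \<in> A\<close>, membership in \<open>\<C>\<close> and in
  \<open>colon_fam \<C> x\<close> agree; for \<open>x \<notin> A\<close>, membership in
  \<open>\<C>\<close> and in \<open>extend_fam \<C> x\<close>. The colon part is only cut from
  below, so no unit of \<open>d\<close> is lost.\<close>

lemma has_partition_complement:
  "split_fam V d \<C> \<Longrightarrow> has_partition V d (Pow V - \<C>)"
proof (induction rule: split_fam.induct)
  case unit
  then show ?case by (simp add: has_partition_empty)
next
  case (prime W)
  have "Pow V - prime_fam W = {{}..V - W}" by (auto simp: prime_fam_def)
  then show ?case using prime has_partition_interval[of "{}" "V - W" V d] by auto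
next
  case (split x \<C>)
  let ?A = "{A \<in> Pow V - colon_fam \<C> x. {x} \<subseteq> A}" and ?B = "Pow V - extend_fam \<C> x"
  have "A \<in> ?A \<union> ?B \<longleftrightarrow> A \<in> Pow V - \<C>" for A
    by (cases "x \<in> A") (simp_all add: colon_fam_def extend_fam_def insert_absorb)
  then have "?A \<union> ?B = Pow V - \<C>" by blast
  moreover have "has_partition V d (?A \<union> ?B)"
    by (rule has_partition_Un[OF has_partition_superset[OF split.IH(1)] split.IH(2)])
      (auto simp: extend_fam_def)
  ultimately show ?case by (rule subst)
qed

text \<open>The ideal is \<open>(W)\<close> plus the product of \<open>Y\<close> times a cover ideal
  not involving \<open>Y\<close>. Dividing by \<open>y\<close> shortens the product; setting
  \<open>y\<close> to zero kills it and leaves the prime of \<open>insert y W\<close>, with one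
  variable fewer, hence the strict inequality for \<open>d\<close>.\<close>

lemma split_fam_nbhd:
  assumes "finite Y" "Y \<subseteq> V" "W \<subseteq> V" "Y \<inter> W = {}" "Y \<inter> \<Union>E = {}"
    and "split_fam V d (prime_fam W \<union> vertex_covers E)" "d < card (V - W)"
  shows "split_fam V d (prime_fam W \<union> {C \<in> vertex_covers E. Y \<subseteq> C})"
  using assms(1,2,4,5)
proof (induction Y rule: finite_induct)
  case empty
  then show ?case using assms(6) by simp
next
  case (insert y Y)
  let ?F = "\<lambda>Y. prime_fam W \<union> {C \<in> vertex_covers E. Y \<subseteq> C}"
  have y: "y \<in> V" "y \<notin> W" "y \<notin> \<Union>E" using insert.prems by simp_all
  have "e \<inter> insert y C = e \<inter> C" if "e \<in> E" for e C using y(3) that by auto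
  then have "insert y C \<in> vertex_covers E \<longleftrightarrow> C \<in> vertex_covers E" for C
    by (simp add: vertex_covers_def)
  moreover have "insert y C \<in> prime_fam W \<longleftrightarrow> C \<in> prime_fam W" for C
    using y(2) by (simp add: prime_fam_def)
  moreover have "insert y Y \<subseteq> insert y C \<longleftrightarrow> Y \<subseteq> C" for C
    using insert.hyps(2) by auto
  ultimately have colon: "colon_fam (?F (insert y Y)) y = ?F Y"
    by (simp add: colon_fam_def set_eq_iff)
  have extend: "extend_fam (?F (insert y Y)) y = prime_fam (insert y W)"
    by (auto simp: extend_fam_def prime_fam_def)
  show ?case
  proof (rule split_fam.split[OF y(1)])
    show "upset (?F (insert y Y))"
      by (intro upset_Un upset_prime_fam upset_vertex_covers)
    show "split_fam V d (colon_fam (?F (insert y Y)) y)"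
      unfolding colon using insert.IH insert.prems by simp
    have "V - insert y W = V - W - {y}" by blast
    then have "card (V - insert y W) = card (V - W) - 1"
      using y(1,2) by (simp only: card_Diff_singleton[of y "V - W"] Diff_iff simp_thms)
    then have "split_fam V d (prime_fam (insert y W))"
      using assms(3,7) y(1) by (intro split_fam.prime) simp_all
    then show "split_fam V d (extend_fam (?F (insert y Y)) y)"
      unfolding extend .
  qed
qed

text \<open>In the branch \<open>(I, x)\<close> the set \<open>W\<close> grows by one element and
  the ordered matching number drops by at least one, so the bound survives; in the branch
  \<open>I : x\<close> only edges disappear.\<close>

lemma split_fam_covers:
  assumes "simple_graph V E" "W \<subseteq> V" "W \<inter> \<Union>E = {}"
  shows "split_fam V (card V - card W - ordered_matching_number E - 1)
    (prime_fam W \<union> vertex_covers E)"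
  using assms
proof (induction "card E" arbitrary: E W rule: less_induct)
  case less
  note G = less.prems(1)
  let ?\<nu> = "ordered_matching_number"
  have finV: "finite V" using G by (simp add: simple_graph_def)
  show ?case
  proof (cases "E = {}")
    case True
    then have "prime_fam W \<union> vertex_covers E = UNIV" by (auto simp: vertex_covers_def)
    then show ?thesis by (simp add: split_fam.unit)
  next
    case False
    then obtain x y where e: "{x, y} \<in> E"
      using simple_graph_edgeE[OF G] by (metis all_not_in_conv)
    have smaller: "card (edges_avoiding E W) < card E" if "x \<in> W" for W
    proof (rule psubset_card_mono[OF simple_graph_finite_edges[OF G]])
      have "{x, y} \<notin> edges_avoiding E W" using that by (auto simp: edges_avoiding_def)
      moreover have "edges_avoiding E W \<subseteq> E" by (auto simp: edges_avoiding_def)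
      ultimately show "edges_avoiding E W \<subset> E" using e by blast
    qed
    let ?d = "card V - card W - ?\<nu> E - 1" and ?C = "prime_fam W \<union> vertex_covers E"
    let ?E1 = "edges_avoiding E {x}" and ?E2 = "edges_avoiding E (insert x (nbhd E x))"
    have xW: "x \<notin> W" "x \<in> V" and yW: "y \<in> V - insert x W"
      using e less.prems(3) simple_graph_edgeD[OF G e] by blast+
    have N: "nbhd E x \<subseteq> V" "nbhd E x \<inter> insert x W = {}"
      using simple_graph_edgeD(2,3)[OF G] less.prems(3) unfolding nbhd_def by blast+
    have \<nu>: "?\<nu> ?E2 < ?\<nu> E" by (rule ordered_matching_number_nbhd_less[OF G e])
    have E1: "split_fam V ?d (prime_fam W \<union> vertex_covers ?E1)"
    proof (rule split_fam_mono)
      have "W \<inter> \<Union>?E1 = {}" using less.prems(3) unfolding edges_avoiding_def by blast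
      then show "split_fam V (card V - card W - ?\<nu> ?E1 - 1) (prime_fam W \<union> vertex_covers ?E1)"
        by (intro less.hyps[OF smaller simple_graph_edges_avoiding[OF G]] less.prems(2)) simp
      show "?d \<le> card V - card W - ?\<nu> ?E1 - 1"
        using ordered_matching_number_edges_avoiding_le[OF G, of "{x}"] by linarith
    qed
    have "insert x C \<in> prime_fam W \<longleftrightarrow> C \<in> prime_fam W" for C
      using xW(1) by (simp add: prime_fam_def)
    moreover have "insert x C \<in> vertex_covers E \<longleftrightarrow> C \<in> vertex_covers ?E1" for C
      unfolding vertex_covers_def edges_avoiding_def by blast
    ultimately have colon: "colon_fam ?C x = prime_fam W \<union> vertex_covers ?E1"
      unfolding colon_fam_def by blast
    have E2: "split_fam V ?d
        (prime_fam (insert x W) \<union> {C \<in> vertex_covers ?E2. nbhd E x \<subseteq> C})"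
    proof (rule split_fam_nbhd)
      have card: "card (insert x W) = Suc (card W)"
        using xW finite_subset[OF less.prems(2) finV] by simp
      show "split_fam V ?d (prime_fam (insert x W) \<union> vertex_covers ?E2)"
      proof (rule split_fam_mono)
        have "insert x W \<inter> \<Union>?E2 = {}" using less.prems(3) unfolding edges_avoiding_def by blast
        then show "split_fam V (card V - card (insert x W) - ?\<nu> ?E2 - 1)
            (prime_fam (insert x W) \<union> vertex_covers ?E2)"
          using xW(2) less.prems(2)
          by (intro less.hyps[OF smaller simple_graph_edges_avoiding[OF G]]) simp_all
        show "?d \<le> card V - card (insert x W) - ?\<nu> ?E2 - 1"
          using \<nu> card by linarith
      qed
      \<comment> \<open>Truncated subtraction again: when \<open>?d\<close> is 0, the strict bound
        needs a variable outside \<open>insert x W\<close>, and \<open>y\<close> is one.\<close>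
      have "card (V - insert x W) > 0"
        using yW finV by (metis card_gt_0_iff empty_iff finite_Diff)
      moreover have "card (V - insert x W) = card V - card (insert x W)"
        using xW(2) less.prems(2) by (intro card_Diff_subset finite_subset[OF _ finV]) auto
      ultimately show "?d < card (V - insert x W)" using \<nu> card by linarith
      show "finite (nbhd E x)" using N(1) finV by (rule finite_subset)
      show "insert x W \<subseteq> V" using xW(2) less.prems(2) by blast
      show "nbhd E x \<inter> \<Union>?E2 = {}" unfolding edges_avoiding_def by blast
    qed (rule N)+
    have ext: "C \<in> extend_fam ?C x \<longleftrightarrow>
        C \<in> prime_fam (insert x W) \<union> {C \<in> vertex_covers ?E2. nbhd E x \<subseteq> C}" for C
      using vertex_covers_avoiding_iff[OF G, of x C]
      by (cases "x \<in> C") (auto simp: extend_fam_def prime_fam_def)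
    then have "extend_fam ?C x =
        prime_fam (insert x W) \<union> {C \<in> vertex_covers ?E2. nbhd E x \<subseteq> C}" by blast
    moreover have "upset ?C"
      using upset_Un[OF upset_prime_fam upset_vertex_covers[of E "{}"]] by simp
    ultimately show ?thesis
      by (intro split_fam.split[OF xW(2), of ?C ?d]) (simp_all only: colon E1 E2)
  qed
qed

section \<open>Monomials and coefficient restriction\<close>

text \<open>The projection onto the span of the monomials in \<open>A\<close>. It yields homogeneous
  components (\<open>A\<close> a degree), the summands of a Stanley decomposition (\<open>A\<close>
  the exponents of an interval) and normal forms modulo a monomial ideal.\<close>

definition restrict_keys :: "'a set \<Rightarrow> ('a \<Rightarrow>\<^sub>0 'b) \<Rightarrow> 'a \<Rightarrow>\<^sub>0 'b::comm_monoid_add" where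
  "restrict_keys A p =
     (\<Sum>m\<in>Poly_Mapping.keys p \<inter> A. Poly_Mapping.single m (Poly_Mapping.lookup p m))"

lemma lookup_restrict_keys:
  "Poly_Mapping.lookup (restrict_keys A p) m = (if m \<in> A then Poly_Mapping.lookup p m else 0)"
proof -
  have "Poly_Mapping.lookup (restrict_keys A p) m =
      (\<Sum>k\<in>Poly_Mapping.keys p \<inter> A. if k = m then Poly_Mapping.lookup p k else 0)"
    by (simp add: restrict_keys_def Poly_Mapping.lookup_sum Poly_Mapping.lookup_single when_def)
  also have "\<dots> = (if m \<in> Poly_Mapping.keys p \<inter> A then Poly_Mapping.lookup p m else 0)"
    by (rule sum.delta) simp
  finally show ?thesis by (simp add: Poly_Mapping.in_keys_iff)
qed

lemma keys_restrict_keys: "Poly_Mapping.keys (restrict_keys A p) = Poly_Mapping.keys p \<inter> A"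
  by (auto simp: Poly_Mapping.in_keys_iff lookup_restrict_keys split: if_splits)

lemma restrict_keys_add: "restrict_keys A (p + q) = restrict_keys A p + restrict_keys A q"
  by (rule poly_mapping_eqI) (simp add: lookup_restrict_keys Poly_Mapping.lookup_add)

lemma restrict_keys_sum: "restrict_keys A (\<Sum>i\<in>X. f i) = (\<Sum>i\<in>X. restrict_keys A (f i))"
  by (rule poly_mapping_eqI) (simp add: lookup_restrict_keys Poly_Mapping.lookup_sum)

lemma restrict_keys_idem: "Poly_Mapping.keys p \<subseteq> A \<Longrightarrow> restrict_keys A p = p"
  by (rule poly_mapping_eqI) (auto simp: lookup_restrict_keys Poly_Mapping.in_keys_iff)

lemma restrict_keys_eq_0: "Poly_Mapping.keys p \<inter> A = {} \<Longrightarrow> restrict_keys A p = 0"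
  by (rule poly_mapping_eqI) (auto simp: lookup_restrict_keys Poly_Mapping.in_keys_iff)

lemma restrict_keys_partition:
  "p = restrict_keys A p + restrict_keys (- A) p"
  by (rule poly_mapping_eqI) (simp add: lookup_restrict_keys Poly_Mapping.lookup_add)

lemma sum_restrict_keys:
  assumes "finite X" "Poly_Mapping.keys p \<subseteq> (\<Union>i\<in>X. A i)"
    and "\<And>i j. i \<in> X \<Longrightarrow> j \<in> X \<Longrightarrow> i \<noteq> j \<Longrightarrow> A i \<inter> A j = {}"
  shows "(\<Sum>i\<in>X. restrict_keys (A i) p) = p"
proof (rule poly_mapping_eqI)
  fix m
  have eq: "Poly_Mapping.lookup (\<Sum>i\<in>X. restrict_keys (A i) p) m =
      (\<Sum>i\<in>X. if m \<in> A i then Poly_Mapping.lookup p m else 0)"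
    by (simp add: Poly_Mapping.lookup_sum lookup_restrict_keys)
  show "Poly_Mapping.lookup (\<Sum>i\<in>X. restrict_keys (A i) p) m = Poly_Mapping.lookup p m"
  proof (cases "m \<in> Poly_Mapping.keys p")
    case True
    then obtain i where i: "i \<in> X" "m \<in> A i" using assms(2) by blast
    then have "m \<in> A j \<longleftrightarrow> j = i" if "j \<in> X" for j
      using assms(3)[of i j] that by blast
    then have "(\<Sum>j\<in>X. if m \<in> A j then Poly_Mapping.lookup p m else 0) =
        (\<Sum>j\<in>X. if j = i then Poly_Mapping.lookup p m else 0)"
      by (intro sum.cong) auto
    also have "\<dots> = Poly_Mapping.lookup p m"
      using assms(1) i(1) by simp
    finally show ?thesis using eq by simp
  next
    case False
    then have "Poly_Mapping.lookup p m = 0" by (simp add: Poly_Mapping.in_keys_iff)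
    then show ?thesis unfolding eq by (intro sum.neutral[THEN trans]) simp_all
  qed
qed

lemma poly_mapping_sum_single:
  "(\<Sum>m\<in>Poly_Mapping.keys p. Poly_Mapping.single m (Poly_Mapping.lookup p m)) = p"
  using restrict_keys_idem[of p UNIV] by (simp add: restrict_keys_def)

lemma keys_add_nat:
  "Poly_Mapping.keys (a + b) = Poly_Mapping.keys a \<union> Poly_Mapping.keys (b :: 'a \<Rightarrow>\<^sub>0 nat)"
  by (auto simp: Poly_Mapping.in_keys_iff Poly_Mapping.lookup_add)

lemma lookup_single_times:
  fixes p :: "('v, 'k::field) mpoly"
  shows "Poly_Mapping.lookup (Poly_Mapping.single t 1 * p) (t + m) = Poly_Mapping.lookup p m"
proof -
  have "Poly_Mapping.single t 1 * p =
      (\<Sum>k\<in>Poly_Mapping.keys p. Poly_Mapping.single (t + k) (Poly_Mapping.lookup p k))"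
    by (subst poly_mapping_sum_single[of p, symmetric])
      (simp add: sum_distrib_left Poly_Mapping.mult_single)
  then have "Poly_Mapping.lookup (Poly_Mapping.single t 1 * p) (t + m) =
      (\<Sum>k\<in>Poly_Mapping.keys p. if k = m then Poly_Mapping.lookup p k else 0)"
    by (simp add: Poly_Mapping.lookup_sum Poly_Mapping.lookup_single when_def)
  also have "\<dots> = Poly_Mapping.lookup p m"
    by (simp add: Poly_Mapping.in_keys_iff)
  finally show ?thesis .
qed

lemma keys_single_times:
  fixes p :: "('v, 'k::field) mpoly"
  shows "Poly_Mapping.keys (Poly_Mapping.single t 1 * p) = (+) t ` Poly_Mapping.keys p"
proof
  show "Poly_Mapping.keys (Poly_Mapping.single t 1 * p) \<subseteq> (+) t ` Poly_Mapping.keys p"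
    using keys_mult[of "Poly_Mapping.single t (1::'k)" p] by auto
  show "(+) t ` Poly_Mapping.keys p \<subseteq> Poly_Mapping.keys (Poly_Mapping.single t 1 * p)"
    by (auto simp: Poly_Mapping.in_keys_iff lookup_single_times)
qed

lemma single_times_eq_0_iff:
  fixes p :: "('v, 'k::field) mpoly"
  shows "Poly_Mapping.single t 1 * p = 0 \<longleftrightarrow> p = 0"
  using keys_single_times[of t p] by (metis image_is_empty keys_eq_empty)

text \<open>\<open>q\<close> arises by lowering every exponent of \<open>p\<close> by
  \<open>t\<close>. Its keys are given exactly, so that the variables occurring in \<open>q\<close>
  can be traced back to \<open>p\<close>.\<close>

lemma single_dvd_poly:
  fixes p :: "('v, 'k::field) mpoly"
  assumes "\<And>m. m \<in> Poly_Mapping.keys p \<Longrightarrow> \<exists>m'. m = t + m'"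
  obtains q where "p = Poly_Mapping.single t 1 * q"
    and "Poly_Mapping.keys q = {m. t + m \<in> Poly_Mapping.keys p}"
proof
  define q where "q = (\<Sum>m\<in>Poly_Mapping.keys p. Poly_Mapping.single (m - t) (Poly_Mapping.lookup p m))"
  have "Poly_Mapping.single t 1 * q =
      (\<Sum>m\<in>Poly_Mapping.keys p. Poly_Mapping.single (t + (m - t)) (Poly_Mapping.lookup p m))"
    unfolding q_def by (simp add: sum_distrib_left Poly_Mapping.mult_single)
  also have "\<dots> = (\<Sum>m\<in>Poly_Mapping.keys p. Poly_Mapping.single m (Poly_Mapping.lookup p m))"
  proof (rule sum.cong)
    fix m assume "m \<in> Poly_Mapping.keys p"
    then obtain m' where "m = t + m'" using assms by blast
    then show "Poly_Mapping.single (t + (m - t)) (Poly_Mapping.lookup p m) =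
        Poly_Mapping.single m (Poly_Mapping.lookup p m)" by simp
  qed simp
  finally show eq: "p = Poly_Mapping.single t 1 * q" by (simp add: poly_mapping_sum_single)
  show "Poly_Mapping.keys q = {m. t + m \<in> Poly_Mapping.keys p}"
    by (subst eq) (auto simp: keys_single_times)
qed

lemma nat_exponent_split:
  fixes m t :: "'v \<Rightarrow>\<^sub>0 nat"
  assumes "\<And>x. Poly_Mapping.lookup t x \<le> Poly_Mapping.lookup m x"
  shows "m = t + (m - t)"
  by (rule poly_mapping_eqI) (simp add: Poly_Mapping.lookup_add Poly_Mapping.lookup_minus assms)

definition sqfree_exp :: "'v set \<Rightarrow> 'v \<Rightarrow>\<^sub>0 nat" where
  "sqfree_exp C = (\<Sum>x\<in>C. Poly_Mapping.single x 1)"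

lemma lookup_sqfree_exp:
  "finite C \<Longrightarrow> Poly_Mapping.lookup (sqfree_exp C) x = (if x \<in> C then 1 else 0)"
  by (simp add: sqfree_exp_def Poly_Mapping.lookup_sum Poly_Mapping.lookup_single when_def)

lemma keys_sqfree_exp: "finite C \<Longrightarrow> Poly_Mapping.keys (sqfree_exp C) = C"
  by (auto simp: Poly_Mapping.in_keys_iff lookup_sqfree_exp split: if_splits)

lemma sqfree_exp_split:
  assumes "finite C" "C \<subseteq> Poly_Mapping.keys m"
  shows "m = sqfree_exp C + (m - sqfree_exp C)"
  using assms
  by (intro nat_exponent_split) (auto simp: lookup_sqfree_exp Poly_Mapping.in_keys_iff Suc_le_eq)

definition sqfree_mon :: "'v set \<Rightarrow> ('v, 'k::field) mpoly" where
  "sqfree_mon C = Poly_Mapping.single (sqfree_exp C) 1"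

lemma pvar_eq_sqfree_mon: "pvar x = sqfree_mon {x}"
  by (simp add: pvar_def sqfree_mon_def sqfree_exp_def)

lemma prod_pvar: "finite C \<Longrightarrow> (\<Prod>x\<in>C. pvar x) = (sqfree_mon C :: ('v, 'k::field) mpoly)"
proof (induction C rule: finite_induct)
  case empty
  then show ?case by (simp add: sqfree_mon_def sqfree_exp_def)
next
  case (insert x C)
  then show ?case by (simp add: sqfree_mon_def sqfree_exp_def pvar_def Poly_Mapping.mult_single)
qed

section \<open>Spans of monomials with prescribed supports\<close>

text \<open>For an up-set this is a squarefree monomial ideal; for the complement of an up-set in
  \<open>Pow V\<close> it is the space of normal forms modulo that ideal.\<close>

definition mon_span :: "'v set \<Rightarrow> 'v set set \<Rightarrow> ('v, 'k::field) mpoly set" where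
  "mon_span V \<F> = {p \<in> polys_in V. \<forall>m\<in>Poly_Mapping.keys p. Poly_Mapping.keys m \<in> \<F>}"

lemma mon_spanI:
  "(\<And>m. m \<in> Poly_Mapping.keys p \<Longrightarrow> Poly_Mapping.keys m \<subseteq> V \<and> Poly_Mapping.keys m \<in> \<F>) \<Longrightarrow>
   p \<in> mon_span V \<F>"
  by (simp add: mon_span_def polys_in_def)

lemma mon_spanD:
  assumes "p \<in> mon_span V \<F>"
  shows "p \<in> polys_in V" "m \<in> Poly_Mapping.keys p \<Longrightarrow> Poly_Mapping.keys m \<subseteq> V"
    "m \<in> Poly_Mapping.keys p \<Longrightarrow> Poly_Mapping.keys m \<in> \<F>"
  using assms by (auto simp: mon_span_def polys_in_def)

lemma mon_span_subset: "mon_span V \<F> \<subseteq> polys_in V"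
  by (auto simp: mon_span_def)

lemma mon_span_zero: "0 \<in> mon_span V \<F>"
  by (simp add: mon_span_def polys_in_def)

lemma mon_span_mono_keys:
  "p \<in> mon_span V \<F> \<Longrightarrow> Poly_Mapping.keys q \<subseteq> Poly_Mapping.keys p \<Longrightarrow> q \<in> mon_span V \<F>"
  by (auto simp: mon_span_def polys_in_def)

lemma mon_span_add:
  "p \<in> mon_span V \<F> \<Longrightarrow> q \<in> mon_span V \<F> \<Longrightarrow> p + q \<in> mon_span V \<F>"
  using Poly_Mapping.keys_add[of p q] by (intro mon_spanI) (blast dest: mon_spanD)

lemma mon_span_uminus: "p \<in> mon_span V \<F> \<Longrightarrow> - p \<in> mon_span V \<F>"
  by (erule mon_span_mono_keys) (auto simp: Poly_Mapping.in_keys_iff)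

lemma mon_span_sum: "(\<And>i. i \<in> X \<Longrightarrow> f i \<in> mon_span V \<F>) \<Longrightarrow> (\<Sum>i\<in>X. f i) \<in> mon_span V \<F>"
  by (induction X rule: infinite_finite_induct) (auto intro: mon_span_add mon_span_zero)

lemma restrict_keys_polys_in: "p \<in> polys_in V \<Longrightarrow> restrict_keys A p \<in> polys_in V"
  by (auto simp: polys_in_def keys_restrict_keys)

lemma sqfree_mon_polys_in: "finite C \<Longrightarrow> C \<subseteq> V \<Longrightarrow> sqfree_mon C \<in> polys_in V"
  by (simp add: sqfree_mon_def polys_in_def keys_sqfree_exp)

lemma pvar_polys_in: "x \<in> V \<Longrightarrow> pvar x \<in> polys_in V"
  by (simp add: pvar_eq_sqfree_mon sqfree_mon_polys_in)

text \<open>The Stanley space \<open>x\<^sup>C K[D]\<close> of an interval \<open>[C, D]\<close> is spanned by the monomials with support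
  in the interval.\<close>

lemma sqfree_mon_times_polys_in:
  assumes "finite C" "C \<subseteq> D"
  shows "{v * sqfree_mon C | v. v \<in> polys_in D} = (mon_span D {C..D} :: ('v, 'k::field) mpoly set)"
proof (intro equalityI subsetI)
  fix p :: "('v, 'k) mpoly" assume "p \<in> {v * sqfree_mon C | v. v \<in> polys_in D}"
  then obtain v where v: "v \<in> polys_in D" "p = sqfree_mon C * v" by (auto simp: mult.commute)
  show "p \<in> mon_span D {C..D}"
  proof (rule mon_spanI)
    fix m assume "m \<in> Poly_Mapping.keys p"
    then obtain k where k: "k \<in> Poly_Mapping.keys v" "m = sqfree_exp C + k"
      unfolding v(2) sqfree_mon_def keys_single_times by blast
    then have "Poly_Mapping.keys k \<subseteq> D" using v(1) by (auto simp: polys_in_def)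
    then show "Poly_Mapping.keys m \<subseteq> D \<and> Poly_Mapping.keys m \<in> {C..D}"
      unfolding k(2) keys_add_nat keys_sqfree_exp[OF assms(1)] using assms(2) by simp
  qed
next
  fix p :: "('v, 'k) mpoly" assume p: "p \<in> mon_span D {C..D}"
  have "\<exists>m'. m = sqfree_exp C + m'" if "m \<in> Poly_Mapping.keys p" for m
    using mon_spanD(3)[OF p that] sqfree_exp_split[OF assms(1), of m] by auto
  then obtain q where q: "p = Poly_Mapping.single (sqfree_exp C) 1 * q"
    "Poly_Mapping.keys q = {m. sqfree_exp C + m \<in> Poly_Mapping.keys p}"
    by (rule single_dvd_poly)
  have "q \<in> polys_in D"
    using mon_spanD(2)[OF p] by (auto simp: polys_in_def q(2) keys_add_nat dest!: mon_spanD(2)[OF p])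
  then show "p \<in> {v * sqfree_mon C | v. v \<in> polys_in D}"
    using q(1) by (auto simp: sqfree_mon_def mult.commute)
qed

section \<open>Regular sequences modulo ideals of a subring\<close>

text \<open>The polynomials in the variables of \<open>V\<close> form a subset of a type that is
  itself a commutative ring. Ideals and sequences are handled there with plain \<open>+\<close> and
  \<open>*\<close>; the ring and module records return only in the final translation.\<close>

locale unital_subring =
  fixes A :: "'a::comm_ring_1 set"
  assumes zero_closed: "0 \<in> A" and one_closed: "1 \<in> A"
    and add_closed: "p \<in> A \<Longrightarrow> q \<in> A \<Longrightarrow> p + q \<in> A"
    and uminus_closed: "p \<in> A \<Longrightarrow> - p \<in> A"
    and times_closed: "p \<in> A \<Longrightarrow> q \<in> A \<Longrightarrow> p * q \<in> A"
begin

definition is_ideal :: "'a set \<Rightarrow> bool" where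
  "is_ideal I \<longleftrightarrow> I \<subseteq> A \<and> 0 \<in> I \<and> (\<forall>p\<in>I. \<forall>q\<in>I. p + q \<in> I) \<and> (\<forall>p\<in>I. \<forall>q\<in>A. p * q \<in> I)"

definition colon :: "'a set \<Rightarrow> 'a \<Rightarrow> 'a set" where
  "colon I x = {p \<in> A. x * p \<in> I}"

definition adjoin :: "'a set \<Rightarrow> 'a \<Rightarrow> 'a set" where
  "adjoin I f = {i + f * q | i q. i \<in> I \<and> q \<in> A}"

definition nonzerodivisor :: "'a set \<Rightarrow> 'a \<Rightarrow> bool" where
  "nonzerodivisor I f \<longleftrightarrow> (\<forall>p\<in>A. f * p \<in> I \<longrightarrow> p \<in> I)"

text \<open>Regularity on \<open>A/I\<close> in the weak sense: the quotient may vanish. The unit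
  ideal thus admits every sequence, as the zero factors of the filtration require; properness is
  settled once, in \<open>regular_sequence_quotient\<close>.\<close>

primrec regular :: "'a set \<Rightarrow> 'a list \<Rightarrow> bool" where
  "regular I [] \<longleftrightarrow> True"
| "regular I (f # fs) \<longleftrightarrow> nonzerodivisor I f \<and> regular (adjoin I f) fs"

lemma is_idealD:
  assumes "is_ideal I"
  shows "p \<in> I \<Longrightarrow> p \<in> A" "0 \<in> I" "p \<in> I \<Longrightarrow> q \<in> I \<Longrightarrow> p + q \<in> I"
    "p \<in> I \<Longrightarrow> q \<in> A \<Longrightarrow> p * q \<in> I" "p \<in> I \<Longrightarrow> q \<in> A \<Longrightarrow> q * p \<in> I"
  using assms by (auto simp: is_ideal_def mult.commute)

lemma is_ideal_diff: "is_ideal I \<Longrightarrow> p \<in> I \<Longrightarrow> q \<in> I \<Longrightarrow> p - q \<in> I"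
  using is_idealD(3)[of I p "q * (- 1)"] is_idealD(4)[of I q "- 1"]
    uminus_closed[OF one_closed] by simp

lemma is_ideal_add_cancel:
  assumes "is_ideal I" "p \<in> I"
  shows "p + q \<in> I \<longleftrightarrow> q \<in> I"
  using is_idealD(3)[OF assms(1,2), of q] is_ideal_diff[OF assms(1) _ assms(2), of "p + q"] by auto

lemma adjoinI: "i \<in> I \<Longrightarrow> q \<in> A \<Longrightarrow> i + f * q \<in> adjoin I f"
  by (auto simp: adjoin_def)

lemma adjoinE:
  assumes "p \<in> adjoin I f"
  obtains i q where "p = i + f * q" "i \<in> I" "q \<in> A"
  using assms by (auto simp: adjoin_def)

lemma adjoin_superset: "I \<subseteq> adjoin I f"
  using adjoinI[OF _ zero_closed, of _ I f] by auto

lemma is_ideal_adjoin: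
  assumes I: "is_ideal I" and f: "f \<in> A"
  shows "is_ideal (adjoin I f)"
  unfolding is_ideal_def
proof (intro conjI ballI subsetI)
  show "p \<in> A" if "p \<in> adjoin I f" for p
    using that by (rule adjoinE) (simp add: is_idealD(1)[OF I] f add_closed times_closed)
  show "0 \<in> adjoin I f" using adjoin_superset is_idealD(2)[OF I] by blast
  show "p + q \<in> adjoin I f" if "p \<in> adjoin I f" "q \<in> adjoin I f" for p q
  proof -
    from that(1) obtain i r where p: "p = i + f * r" "i \<in> I" "r \<in> A" by (rule adjoinE)
    from that(2) obtain j s where q: "q = j + f * s" "j \<in> I" "s \<in> A" by (rule adjoinE)
    have "p + q = (i + j) + f * (r + s)" using p(1) q(1) by (simp add: algebra_simps)
    then show ?thesis
      using adjoinI[OF is_idealD(3)[OF I p(2) q(2)] add_closed[OF p(3) q(3)]] by simp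
  qed
  show "p * q \<in> adjoin I f" if "p \<in> adjoin I f" "q \<in> A" for p q
  proof -
    from that(1) obtain i r where p: "p = i + f * r" "i \<in> I" "r \<in> A" by (rule adjoinE)
    have "p * q = i * q + f * (r * q)" using p(1) by (simp add: algebra_simps)
    then show ?thesis
      using adjoinI[OF is_idealD(4)[OF I p(2) that(2)] times_closed[OF p(3) that(2)]] by simp
  qed
qed

lemma nonzerodivisor_times:
  assumes "nonzerodivisor I f" "nonzerodivisor I g" "g \<in> A"
  shows "nonzerodivisor I (f * g)"
  using assms by (auto simp: nonzerodivisor_def mult.assoc times_closed)

lemma nonzerodivisor_prod:
  assumes "finite X" "\<And>x. x \<in> X \<Longrightarrow> nonzerodivisor I (f x)" "\<And>x. x \<in> X \<Longrightarrow> f x \<in> A"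
  shows "nonzerodivisor I (\<Prod>x\<in>X. f x)"
proof -
  have "nonzerodivisor I (\<Prod>x\<in>X. f x) \<and> (\<Prod>x\<in>X. f x) \<in> A"
    using assms
    by (induction X rule: finite_induct)
      (auto simp: one_closed times_closed nonzerodivisor_times nonzerodivisor_def[of _ 1])
  then show ?thesis ..
qed

lemma nonzerodivisor_add:
  assumes I: "is_ideal I" and "i \<in> I"
  shows "nonzerodivisor I (i + f) \<longleftrightarrow> nonzerodivisor I f"
  using is_ideal_add_cancel[OF I is_idealD(4)[OF I assms(2)]]
  by (auto simp: nonzerodivisor_def distrib_right)

lemma adjoin_commute: "adjoin (adjoin I f) g = adjoin (adjoin I g) f"
proof -
  have "adjoin (adjoin I f) g \<subseteq> adjoin (adjoin I g) f" for f g
  proof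
    fix p assume "p \<in> adjoin (adjoin I f) g"
    then obtain i q r where "p = (i + f * q) + g * r" "i \<in> I" "q \<in> A" "r \<in> A"
      by (auto elim!: adjoinE)
    then have "p = (i + g * r) + f * q" by simp
    then show "p \<in> adjoin (adjoin I g) f"
      using adjoinI[OF adjoinI[OF \<open>i \<in> I\<close> \<open>r \<in> A\<close>] \<open>q \<in> A\<close>] by simp
  qed
  then show ?thesis by blast
qed

text \<open>From \<open>x p = i + f q\<close> one gets \<open>f q \<in> (I, x)\<close>, so
  \<open>q = j + x r\<close> with \<open>j \<in> I\<close> because \<open>f\<close> is regular
  modulo \<open>(I, x)\<close>; hence \<open>x (p - f r) \<in> I\<close>. This lets the induction in
  \<open>regular_split\<close> pass from \<open>I\<close> to \<open>(I, f)\<close>.\<close>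

lemma colon_adjoin:
  assumes I: "is_ideal I" and f: "f \<in> A" and x: "x \<in> A"
    and reg: "nonzerodivisor (adjoin I x) f"
  shows "colon (adjoin I f) x = adjoin (colon I x) f"
proof (intro equalityI subsetI)
  fix p assume "p \<in> colon (adjoin I f) x"
  then have p: "p \<in> A" "x * p \<in> adjoin I f" by (auto simp: colon_def)
  from p(2) obtain i q where q: "x * p = i + f * q" "i \<in> I" "q \<in> A" by (rule adjoinE)
  have "f * q = i * (- 1) + x * p" using q(1) by simp
  moreover have "i * (- 1) \<in> I"
    using is_idealD(4)[OF I q(2) uminus_closed[OF one_closed]] .
  ultimately have "f * q \<in> adjoin I x" using adjoinI[OF _ p(1), of "i * (- 1)" I x] by simp
  then have "q \<in> adjoin I x" using reg q(3) by (simp add: nonzerodivisor_def)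
  then obtain j r where r: "q = j + x * r" "j \<in> I" "r \<in> A" by (rule adjoinE)
  have "x * (p - f * r) = i + f * j" using q(1) r(1) by (simp add: algebra_simps)
  also have "\<dots> \<in> I" by (intro is_idealD(3,5)[OF I] q r f)
  finally have "p - f * r \<in> colon I x"
    using add_closed[OF p(1) uminus_closed[OF times_closed[OF f r(3)]]] by (simp add: colon_def)
  from adjoinI[OF this r(3), of f] show "p \<in> adjoin (colon I x) f" by simp
next
  fix p assume "p \<in> adjoin (colon I x) f"
  then obtain i q where q: "p = i + f * q" "i \<in> colon I x" "q \<in> A" by (rule adjoinE)
  have "x * p = x * i + f * (x * q)" using q(1) by (simp add: algebra_simps)
  moreover have "i \<in> A" "x * i \<in> I" using q(2) by (auto simp: colon_def)
  ultimately show "p \<in> colon (adjoin I f) x"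
    using adjoinI[OF \<open>x * i \<in> I\<close> times_closed[OF x q(3)], of f] q f
    by (simp add: colon_def add_closed times_closed)
qed

text \<open>The depth lemma for \<open>0 \<rightarrow> S/(I : x) \<rightarrow> S/I \<rightarrow> S/(I, x) \<rightarrow> 0\<close>, for one fixed sequence.\<close>

lemma regular_split:
  assumes "is_ideal I" "x \<in> A" "set fs \<subseteq> A"
    and "regular (colon I x) fs" "regular (adjoin I x) fs"
  shows "regular I fs"
  using assms
proof (induction fs arbitrary: I)
  case (Cons f fs)
  note I = Cons.prems(1)
  have f: "f \<in> A" and reg: "nonzerodivisor (colon I x) f" "nonzerodivisor (adjoin I x) f"
    using Cons.prems by auto
  have "nonzerodivisor I f"
    unfolding nonzerodivisor_def
  proof (intro ballI impI)
    fix p assume p: "p \<in> A" "f * p \<in> I"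
    then have "p \<in> adjoin I x" using reg(2) adjoin_superset by (auto simp: nonzerodivisor_def)
    then obtain i q where q: "p = i + x * q" "i \<in> I" "q \<in> A" by (rule adjoinE)
    have "f * p = f * i + x * (f * q)" using q(1) by (simp add: algebra_simps)
    then have "x * (f * q) \<in> I"
      using p(2) is_ideal_add_cancel[OF I is_idealD(5)[OF I q(2) f]] by simp
    then have "f * q \<in> colon I x" using times_closed[OF f q(3)] by (simp add: colon_def)
    then have "q \<in> colon I x" using reg(1) q(3) by (simp add: nonzerodivisor_def)
    then show "p \<in> I" using q is_idealD(3)[OF I] by (simp add: colon_def)
  qed
  moreover have "regular (adjoin I f) fs"
  proof (rule Cons.IH[OF is_ideal_adjoin[OF I f] Cons.prems(2)])
    show "regular (colon (adjoin I f) x) fs"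
      using Cons.prems(4) colon_adjoin[OF I f Cons.prems(2) reg(2)] by simp
    show "regular (adjoin (adjoin I f) x) fs"
      using Cons.prems(5) adjoin_commute[of I f x] by simp
  qed (use Cons.prems in simp)
  ultimately show ?case by simp
qed simp

lemma regular_append:
  "regular I (fs @ gs) \<longleftrightarrow> regular I fs \<and> regular (foldl adjoin I fs) gs"
  by (induction fs arbitrary: I) auto

lemma is_ideal_foldl_adjoin:
  "is_ideal I \<Longrightarrow> set fs \<subseteq> A \<Longrightarrow> is_ideal (foldl adjoin I fs)"
  by (induction fs arbitrary: I) (auto intro: is_ideal_adjoin)

lemma foldl_adjoin_superset: "I \<subseteq> foldl adjoin I fs"
  by (induction fs arbitrary: I) (use adjoin_superset in fastforce)+

lemma regular_nth:
  "regular I fs \<Longrightarrow> i < length fs \<Longrightarrow> nonzerodivisor (foldl adjoin I (take i fs)) (fs ! i)"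
proof (induction fs arbitrary: I i)
  case (Cons f fs)
  then show ?case by (cases i) auto
qed simp

lemma is_ideal_unit: "is_ideal A"
  by (simp add: is_ideal_def zero_closed add_closed times_closed)

lemma regular_unit: "set fs \<subseteq> A \<Longrightarrow> regular A fs"
proof (induction fs)
  case (Cons f fs)
  have "adjoin A f = A"
    using adjoin_superset[of A f] is_idealD(1)[OF is_ideal_adjoin[OF is_ideal_unit]] Cons.prems
    by (intro equalityI subsetI) auto
  then show ?case using Cons by (simp add: nonzerodivisor_def)
qed simp

end

section \<open>Elementary symmetric polynomials as a regular sequence\<close>

locale poly_subring = unital_subring A for A :: "('v, 'k::field) mpoly set" +
  fixes V :: "'v set"
  assumes carrier: "A = polys_in V" and finite_vars: "finite V"
begin

section \<open>Homogeneous components and graded ideals\<close>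

definition total_degree :: "('v \<Rightarrow>\<^sub>0 nat) \<Rightarrow> nat" where
  "total_degree m = (\<Sum>x\<in>V. Poly_Mapping.lookup m x)"

definition hcomp :: "nat \<Rightarrow> ('v, 'k) mpoly \<Rightarrow> ('v, 'k) mpoly" where
  "hcomp d p = restrict_keys {m. total_degree m = d} p"

definition homogeneous :: "nat \<Rightarrow> ('v, 'k) mpoly \<Rightarrow> bool" where
  "homogeneous d p \<longleftrightarrow> (\<forall>m\<in>Poly_Mapping.keys p. total_degree m = d)"

definition graded :: "('v, 'k) mpoly set \<Rightarrow> bool" where
  "graded I \<longleftrightarrow> (\<forall>p\<in>I. \<forall>d. hcomp d p \<in> I)"

lemma total_degree_add: "total_degree (m + k) = total_degree m + total_degree k"
  by (simp add: total_degree_def Poly_Mapping.lookup_add sum.distrib)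

lemma keys_hcomp: "Poly_Mapping.keys (hcomp d p) = {m \<in> Poly_Mapping.keys p. total_degree m = d}"
  by (auto simp: hcomp_def keys_restrict_keys)

lemma homogeneous_hcomp: "homogeneous d (hcomp d p)"
  by (simp add: homogeneous_def keys_hcomp)

lemma hcomp_homogeneous: "homogeneous d p \<Longrightarrow> hcomp d p = p"
  unfolding hcomp_def homogeneous_def by (intro restrict_keys_idem) auto

lemma hcomp_closed: "p \<in> A \<Longrightarrow> hcomp d p \<in> A"
  unfolding carrier hcomp_def by (rule restrict_keys_polys_in)

lemma hcomp_add: "hcomp d (p + q) = hcomp d p + hcomp d q"
  by (simp add: hcomp_def restrict_keys_add)

lemma sum_hcomp: "(\<Sum>d\<in>total_degree ` Poly_Mapping.keys p. hcomp d p) = p"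
  unfolding hcomp_def by (rule sum_restrict_keys) auto

lemma keys_homogeneous_times:
  assumes "homogeneous e f" "m \<in> Poly_Mapping.keys (f * p)"
  obtains k where "k \<in> Poly_Mapping.keys p" "total_degree m = e + total_degree k"
proof -
  obtain j k where "m = j + k" "j \<in> Poly_Mapping.keys f" "k \<in> Poly_Mapping.keys p"
    using assms(2) keys_mult[of f p] by blast
  then show thesis using that assms(1) by (simp add: homogeneous_def total_degree_add)
qed

lemma hcomp_times:
  assumes "homogeneous e f"
  shows "hcomp (e + d) (f * p) = f * hcomp d p"
proof -
  let ?q = "restrict_keys (- {m. total_degree m = d}) p"
  have "p = hcomp d p + ?q"
    unfolding hcomp_def by (rule restrict_keys_partition)
  then have "f * p = f * hcomp d p + f * ?q"
    by (metis distrib_left)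
  moreover have "hcomp (e + d) (f * ?q) = 0"
    unfolding hcomp_def
  proof (rule restrict_keys_eq_0)
    show "Poly_Mapping.keys (f * ?q) \<inter> {m. total_degree m = e + d} = {}"
      by (auto simp: keys_restrict_keys elim!: keys_homogeneous_times[OF assms])
  qed
  moreover have "homogeneous (e + d) (f * hcomp d p)"
    unfolding homogeneous_def
    by (auto simp: keys_hcomp elim!: keys_homogeneous_times[OF assms])
  ultimately show ?thesis by (simp add: hcomp_add hcomp_homogeneous)
qed

lemma hcomp_times_less:
  assumes "homogeneous e f" "d < e"
  shows "hcomp d (f * p) = 0"
  unfolding hcomp_def
  by (rule restrict_keys_eq_0) (use assms(2) in \<open>auto elim!: keys_homogeneous_times[OF assms(1)]\<close>)

section \<open>Moving a linear form behind a homogeneous regular sequence\<close>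

lemma graded_adjoin:
  assumes I: "is_ideal I" "graded I" and f: "homogeneous e f"
  shows "graded (adjoin I f)"
  unfolding graded_def
proof (intro ballI allI)
  fix p d assume "p \<in> adjoin I f"
  then obtain i q where q: "p = i + f * q" "i \<in> I" "q \<in> A" by (rule adjoinE)
  have i: "hcomp d i \<in> I" using I(2) q(2) by (simp add: graded_def)
  show "hcomp d p \<in> adjoin I f"
  proof (cases "d < e")
    case True
    then show ?thesis
      using i adjoin_superset[of I f] by (auto simp: q(1) hcomp_add hcomp_times_less[OF f])
  next
    case False
    then show ?thesis
      using adjoinI[OF i hcomp_closed[OF q(3)]] hcomp_times[OF f, of "d - e" q]
      by (simp add: q(1) hcomp_add)
  qed
qed

text \<open>Graded Nakayama: \<open>f p \<in> I\<close> forces \<open>p \<in> I + z S\<close>, and one descends along the degree of \<open>p\<close>.\<close>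

lemma nonzerodivisor_descend:
  assumes I: "is_ideal I" "graded I" and z: "z \<in> A" "homogeneous 1 z" "nonzerodivisor I z"
    and f: "f \<in> A" "homogeneous e f" "nonzerodivisor (adjoin I z) f"
  shows "nonzerodivisor I f"
  unfolding nonzerodivisor_def
proof (intro ballI impI)
  fix p assume p: "p \<in> A" "f * p \<in> I"
  have hom: "q \<in> I" if "q \<in> A" "homogeneous d q" "f * q \<in> I" for d q
    using that
  proof (induction d arbitrary: q rule: less_induct)
    case (less d)
    have "q \<in> adjoin I z"
      using f(3) less.prems adjoin_superset[of I z] by (auto simp: nonzerodivisor_def)
    then obtain i r where r: "q = i + z * r" "i \<in> I" "r \<in> A" by (rule adjoinE)
    have i: "hcomp d i \<in> I" using I(2) r(2) by (simp add: graded_def)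
    have q: "q = hcomp d i + hcomp d (z * r)"
      using hcomp_homogeneous[OF less.prems(2)] by (simp add: r(1) hcomp_add)
    show ?case
    proof (cases d)
      case 0
      then show ?thesis using q i hcomp_times_less[OF z(2), of d] by simp
    next
      case (Suc d')
      have q': "q = hcomp d i + z * hcomp d' r"
        using q hcomp_times[OF z(2), of d' r] Suc by simp
      have "f * q = f * hcomp d i + z * (f * hcomp d' r)"
        by (subst q') (simp add: algebra_simps)
      then have "z * (f * hcomp d' r) \<in> I"
        using less.prems(3) is_ideal_add_cancel[OF I(1) is_idealD(5)[OF I(1) i f(1)]] by simp
      then have "f * hcomp d' r \<in> I"
        using z(3) times_closed[OF f(1) hcomp_closed[OF r(3)]] by (simp add: nonzerodivisor_def)
      then have "hcomp d' r \<in> I"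
        using less.IH[OF _ hcomp_closed[OF r(3)] homogeneous_hcomp] Suc by simp
      then show ?thesis
        using is_idealD(3)[OF I(1) i is_idealD(5)[OF I(1) _ z(1)]] q' by simp
    qed
  qed
  have "hcomp d p \<in> I" for d
  proof (rule hom[OF hcomp_closed[OF p(1)] homogeneous_hcomp])
    have "hcomp (e + d) (f * p) \<in> I" using I(2) p(2) by (simp add: graded_def)
    then show "f * hcomp d p \<in> I" by (simp add: hcomp_times[OF f(2)])
  qed
  moreover have "(\<Sum>d\<in>X. hcomp d p) \<in> I" if "\<And>d. hcomp d p \<in> I" for X
    by (induction X rule: infinite_finite_induct) (use that is_idealD(2,3)[OF I(1)] in auto)
  ultimately show "p \<in> I" by (metis sum_hcomp)
qed

text \<open>The half of the exchange of \<open>z\<close> and \<open>f\<close> that is free of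
  degrees: \<open>colon_adjoin\<close> turns \<open>(I, f) : z\<close> into
  \<open>(I : z) + (f)\<close>, and \<open>I : z \<subseteq> I\<close>.\<close>

lemma nonzerodivisor_adjoin:
  assumes I: "is_ideal I" and f: "f \<in> A" and z: "z \<in> A" "nonzerodivisor I z"
    and reg: "nonzerodivisor (adjoin I z) f"
  shows "nonzerodivisor (adjoin I f) z"
  unfolding nonzerodivisor_def
proof (intro ballI impI)
  fix p assume p: "p \<in> A" "z * p \<in> adjoin I f"
  then have "p \<in> colon (adjoin I f) z" by (simp add: colon_def)
  then have "p \<in> adjoin (colon I z) f" by (simp add: colon_adjoin[OF I f z(1) reg])
  moreover have "colon I z \<subseteq> I" using z(2) by (auto simp: colon_def nonzerodivisor_def)
  ultimately show "p \<in> adjoin I f" by (auto simp: adjoin_def)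
qed

text \<open>A regular sequence \<open>z, f1, ..., fk\<close> is permuted to
  \<open>f1, ..., fk, z\<close>. Regularity modulo \<open>z\<close> concerns one variable fewer and
  comes by induction; that \<open>z\<close> is still a nonzerodivisor at the end is what the last
  elementary symmetric polynomial needs in \<open>regular_prime\<close>.\<close>

lemma regular_permute:
  assumes "is_ideal I" "graded I" "z \<in> A" "homogeneous 1 z" "nonzerodivisor I z"
    and "set fs \<subseteq> A" "\<forall>f\<in>set fs. \<exists>e. homogeneous e f" "regular (adjoin I z) fs"
  shows "regular I fs \<and> nonzerodivisor (foldl adjoin I fs) z"
  using assms(1,2,5-8)
proof (induction fs arbitrary: I)
  case (Cons f fs)
  obtain e where e: "homogeneous e f" using Cons.prems(5) by auto
  have f: "f \<in> A" "nonzerodivisor (adjoin I z) f" using Cons.prems by auto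
  have "nonzerodivisor I f"
    by (rule nonzerodivisor_descend[OF Cons.prems(1,2) assms(3,4) Cons.prems(3) f(1) e f(2)])
  moreover have "regular (adjoin I f) fs \<and> nonzerodivisor (foldl adjoin (adjoin I f) fs) z"
  proof (rule Cons.IH)
    show "is_ideal (adjoin I f)" by (rule is_ideal_adjoin[OF Cons.prems(1) f(1)])
    show "graded (adjoin I f)" by (rule graded_adjoin[OF Cons.prems(1,2) e])
    show "nonzerodivisor (adjoin I f) z"
      by (rule nonzerodivisor_adjoin[OF Cons.prems(1) f(1) assms(3) Cons.prems(3) f(2)])
    show "regular (adjoin (adjoin I f) z) fs"
      using Cons.prems(6) adjoin_commute[of I f z] by simp
  qed (use Cons.prems in auto)
  ultimately show ?case by simp
qed simp

section \<open>Monomial ideals, their colons and their extensions by a variable\<close>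

lemma is_ideal_mon_span:
  assumes "upset \<C>"
  shows "is_ideal (mon_span V \<C>)"
  unfolding is_ideal_def
proof (intro conjI ballI)
  show "mon_span V \<C> \<subseteq> A" unfolding carrier by (rule mon_span_subset)
  show "p * q \<in> mon_span V \<C>" if p: "p \<in> mon_span V \<C>" and q: "q \<in> A" for p q
  proof (rule mon_spanI)
    fix m assume "m \<in> Poly_Mapping.keys (p * q)"
    then obtain j k where m: "m = j + k" "j \<in> Poly_Mapping.keys p" "k \<in> Poly_Mapping.keys q"
      using keys_mult[of p q] by blast
    have "Poly_Mapping.keys j \<subseteq> V" "Poly_Mapping.keys j \<in> \<C>" "Poly_Mapping.keys k \<subseteq> V"
      using mon_spanD(2,3)[OF p m(2)] q m(3) by (auto simp: carrier polys_in_def)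
    then show "Poly_Mapping.keys m \<subseteq> V \<and> Poly_Mapping.keys m \<in> \<C>"
      using assms unfolding m(1) keys_add_nat upset_def by blast
  qed
qed (auto intro: mon_span_zero mon_span_add)

lemma graded_mon_span: "graded (mon_span V \<C>)"
  by (auto simp: graded_def keys_hcomp intro: mon_span_mono_keys)

lemma pvar_closed: "x \<in> V \<Longrightarrow> pvar x \<in> A"
  unfolding carrier by (rule pvar_polys_in)

lemma keys_pvar_times:
  "Poly_Mapping.keys (pvar x * p :: ('v, 'k) mpoly) = (+) (Poly_Mapping.single x 1) ` Poly_Mapping.keys p"
  by (simp add: pvar_def keys_single_times)

lemma colon_mon_span:
  assumes "x \<in> V"
  shows "colon (mon_span V \<C>) (pvar x) = mon_span V (colon_fam \<C> x)"
  unfolding colon_def unfolding carrier using assms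
  by (auto simp: mon_span_def colon_fam_def keys_pvar_times keys_add_nat polys_in_mult pvar_polys_in)

lemma adjoin_mon_span:
  assumes "upset \<C>" "x \<in> V"
  shows "adjoin (mon_span V \<C>) (pvar x) = mon_span V (extend_fam \<C> x)"
proof (intro equalityI subsetI)
  fix p assume "p \<in> adjoin (mon_span V \<C>) (pvar x)"
  then obtain i q where q: "p = i + pvar x * q" "i \<in> mon_span V \<C>" "q \<in> A" by (rule adjoinE)
  have "i \<in> mon_span V (extend_fam \<C> x)"
    using q(2) by (auto simp: mon_span_def extend_fam_def)
  moreover have "pvar x * q \<in> mon_span V (extend_fam \<C> x)"
  proof -
    have "pvar x * q \<in> polys_in V"
      using times_closed[OF pvar_closed[OF assms(2)] q(3)] by (simp add: carrier)
    then show ?thesis by (auto simp: mon_span_def extend_fam_def keys_pvar_times keys_add_nat)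
  qed
  ultimately show "p \<in> mon_span V (extend_fam \<C> x)" unfolding q(1) by (rule mon_span_add)
next
  fix p :: "('v, 'k) mpoly" assume p: "p \<in> mon_span V (extend_fam \<C> x)"
  \<comment> \<open>The terms divisible by \<open>x\<close> form the multiple of \<open>x\<close>;
    the other terms have their support in \<open>\<C>\<close> itself.\<close>
  let ?X = "{m. x \<in> Poly_Mapping.keys m}"
  have "\<exists>m'. m = Poly_Mapping.single x 1 + m'" if "m \<in> Poly_Mapping.keys (restrict_keys ?X p)" for m
    using sqfree_exp_split[of "{x}" m] that by (auto simp: keys_restrict_keys sqfree_exp_def)
  then obtain q where q: "restrict_keys ?X p = Poly_Mapping.single (Poly_Mapping.single x 1) 1 * q"
    "Poly_Mapping.keys q = {m. Poly_Mapping.single x 1 + m \<in> Poly_Mapping.keys (restrict_keys ?X p)}"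
    by (rule single_dvd_poly)
  have "q \<in> A"
    unfolding carrier polys_in_def
  proof (intro CollectI ballI)
    fix m assume "m \<in> Poly_Mapping.keys q"
    then have "Poly_Mapping.single x 1 + m \<in> Poly_Mapping.keys p"
      unfolding q(2) by (simp add: keys_restrict_keys)
    from mon_spanD(2)[OF p this] show "Poly_Mapping.keys m \<subseteq> V" by (simp add: keys_add_nat)
  qed
  moreover have "restrict_keys (- ?X) p \<in> mon_span V \<C>"
    using mon_spanD(2,3)[OF p] by (intro mon_spanI) (auto simp: keys_restrict_keys extend_fam_def)
  ultimately have "restrict_keys (- ?X) p + pvar x * q \<in> adjoin (mon_span V \<C>) (pvar x)"
    by (intro adjoinI)
  moreover have "restrict_keys (- ?X) p + pvar x * q = p"
    using restrict_keys_partition[of p ?X] q(1) by (simp add: pvar_def add.commute)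
  ultimately show "p \<in> adjoin (mon_span V \<C>) (pvar x)" by simp
qed

lemma nonzerodivisor_prime:
  assumes "x \<in> V - W"
  shows "nonzerodivisor (mon_span V (prime_fam W)) (pvar x)"
proof -
  have "colon_fam (prime_fam W) x = prime_fam W"
    using assms by (auto simp: colon_fam_def prime_fam_def)
  then have "colon (mon_span V (prime_fam W)) (pvar x) = mon_span V (prime_fam W)"
    using assms by (simp add: colon_mon_span)
  then show ?thesis by (auto simp: colon_def nonzerodivisor_def)
qed

section \<open>Elementary symmetric polynomials modulo variables\<close>

definition esym :: "nat \<Rightarrow> ('v, 'k) mpoly" where
  "esym d = (\<Sum>F | F \<subseteq> V \<and> card F = d. sqfree_mon F)"

lemma total_degree_sqfree_exp:
  assumes "F \<subseteq> V"
  shows "total_degree (sqfree_exp F) = card F"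
proof -
  have "total_degree (sqfree_exp F) = (\<Sum>x\<in>V. if x \<in> F then 1 else 0)"
    using finite_subset[OF assms finite_vars] by (simp add: total_degree_def lookup_sqfree_exp)
  also have "\<dots> = card F"
    using assms finite_vars by (simp add: sum.If_cases Int_absorb1)
  finally show ?thesis .
qed

lemma homogeneous_esym: "homogeneous d (esym d)"
  unfolding homogeneous_def
proof
  fix m assume "m \<in> Poly_Mapping.keys (esym d)"
  then have "m \<in> (\<Union>F\<in>{F. F \<subseteq> V \<and> card F = d}. Poly_Mapping.keys (sqfree_mon F :: ('v, 'k) mpoly))"
    unfolding esym_def by (rule subsetD[OF keys_sum])
  then show "total_degree m = d"
    by (auto simp: sqfree_mon_def total_degree_sqfree_exp)
qed

lemma homogeneous_pvar: "x \<in> V \<Longrightarrow> homogeneous 1 (pvar x)"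
  using total_degree_sqfree_exp[of "{x}"]
  by (simp add: homogeneous_def pvar_def sqfree_exp_def)

lemma esym_closed: "esym d \<in> A"
proof -
  have *: "(\<Sum>F\<in>X. sqfree_mon F) \<in> A" if "\<And>F. F \<in> X \<Longrightarrow> F \<subseteq> V" for X :: "'v set set"
    using that
    by (induction X rule: infinite_finite_induct)
      (auto simp: carrier polys_in_zero_one intro!: polys_in_add sqfree_mon_polys_in
        finite_subset[OF _ finite_vars])
  show ?thesis unfolding esym_def by (rule *) simp
qed

text \<open>Only \<open>V - W\<close> itself is a \<open>d\<close>-subset of \<open>V\<close>
  disjoint from \<open>W\<close>; every other term of \<open>esym d\<close> contains a variable of
  \<open>W\<close>.\<close>

lemma esym_mod_prime:
  assumes W: "W \<subseteq> V" "card (V - W) = d"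
  obtains i where "i \<in> mon_span V (prime_fam W)" "esym d = i + (\<Prod>x\<in>V - W. pvar x)"
proof
  let ?X = "{F. F \<subseteq> V \<and> card F = d}"
  define i where "i = (\<Sum>F\<in>?X - {V - W}. sqfree_mon F :: ('v, 'k) mpoly)"
  have "finite ?X" using finite_vars by simp
  then show "esym d = i + (\<Prod>x\<in>V - W. pvar x)"
    using W finite_vars sum.remove[of ?X "V - W" "sqfree_mon :: _ \<Rightarrow> ('v, 'k) mpoly"]
    by (simp add: esym_def i_def prod_pvar add.commute)
  show "i \<in> mon_span V (prime_fam W)"
    unfolding i_def
  proof (rule mon_span_sum)
    fix F assume F: "F \<in> ?X - {V - W}"
    have "F \<inter> W \<noteq> {}"
    proof
      assume "F \<inter> W = {}"
      then have "F \<subseteq> V - W" using F by blast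
      then have "F = V - W" using F W(2) finite_vars by (intro card_subset_eq) auto
      then show False using F by blast
    qed
    moreover have "finite F" using F finite_subset[OF _ finite_vars] by blast
    ultimately show "sqfree_mon F \<in> mon_span V (prime_fam W)"
      using F by (intro mon_spanI) (auto simp: sqfree_mon_def keys_sqfree_exp prime_fam_def)
  qed
qed

lemma esym_list_closed: "set (map esym ks) \<subseteq> A"
  using esym_closed by auto

text \<open>Induction on the number \<open>n + 1\<close> of surviving variables. Modulo one more
  variable \<open>z\<close>, the \<open>esym k\<close> with \<open>1 \<le> k \<le> n\<close> are
  regular; \<open>regular_permute\<close> lifts this and puts \<open>z\<close> behind them. What
  remains is \<open>esym (n + 1)\<close>, which modulo \<open>W\<close> is the product of all
  surviving variables, each of which is such a \<open>z\<close>.\<close>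

lemma regular_prime:
  assumes "W \<subseteq> V" "d \<le> card (V - W)"
  shows "regular (mon_span V (prime_fam W)) (map esym [1..<Suc d])"
  using assms
proof (induction "card (V - W)" arbitrary: W d)
  case 0
  then show ?case by simp
next
  case (Suc n)
  let ?I = "mon_span V (prime_fam W)"
  have I: "is_ideal ?I" by (rule is_ideal_mon_span[OF upset_prime_fam])
  \<comment> \<open>Stated for every surviving \<open>z\<close>, since the top degree needs all of
    them as nonzerodivisors modulo one and the same ideal.\<close>
  have step: "regular ?I (map esym [1..<Suc k]) \<and>
      nonzerodivisor (foldl adjoin ?I (map esym [1..<Suc k])) (pvar z)"
    if z: "z \<in> V - W" and k: "k \<le> n" for z k
  proof (rule regular_permute[OF I graded_mon_span])
    have "extend_fam (prime_fam W) z = prime_fam (insert z W)"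
      by (auto simp: extend_fam_def prime_fam_def)
    then have "adjoin ?I (pvar z) = mon_span V (prime_fam (insert z W))"
      using z by (simp add: adjoin_mon_span upset_prime_fam)
    moreover have "V - insert z W = V - W - {z}" by blast
    then have "card (V - insert z W) = n"
      using z Suc.hyps(2) by (simp only: card_Diff_singleton[OF z])
    ultimately show "regular (adjoin ?I (pvar z)) (map esym [1..<Suc k])"
      using Suc.hyps(1)[of "insert z W" k] z k Suc.prems(1) by simp
    show "\<forall>f\<in>set (map esym [1..<Suc k]). \<exists>e. homogeneous e f"
      using homogeneous_esym by auto
  qed (use z in \<open>auto simp: pvar_closed homogeneous_pvar[unfolded One_nat_def] nonzerodivisor_prime esym_closed\<close>)
  have "V - W \<noteq> {}" using Suc.hyps(2) by (metis card.empty nat.distinct(1))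
  then obtain z where z: "z \<in> V - W" by blast
  show ?case
  proof (cases "d \<le> n")
    case True
    then show ?thesis using step[OF z] by blast
  next
    case False
    then have d: "d = Suc n" using Suc by simp
    let ?J = "foldl adjoin ?I (map esym [1..<Suc n])"
    have J: "is_ideal ?J" by (rule is_ideal_foldl_adjoin[OF I esym_list_closed])
    obtain i where i: "i \<in> ?I" "esym d = i + (\<Prod>x\<in>V - W. pvar x)"
      using esym_mod_prime[OF Suc.prems(1), of d] Suc.hyps(2) d by metis
    have "nonzerodivisor ?J (\<Prod>x\<in>V - W. pvar x)"
      using step finite_vars by (intro nonzerodivisor_prod) (auto intro: pvar_closed)
    then have "nonzerodivisor ?J (esym d)"
      unfolding i(2) using nonzerodivisor_add[OF J] i(1) foldl_adjoin_superset by blast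
    moreover have "map esym [1..<Suc d] = map esym [1..<Suc n] @ [esym d]"
      by (simp add: d)
    ultimately show ?thesis
      using step[OF z, of n] by (simp only: regular_append regular.simps order_refl simp_thms)
  qed
qed

text \<open>The sequence is the same at every node of the derivation, so
  \<open>regular_split\<close> can glue the two branches.\<close>

lemma regular_split_fam:
  assumes "split_fam V d \<C>"
  shows "regular (mon_span V \<C>) (map esym [1..<Suc d])"
  using assms
proof (induction rule: split_fam.induct)
  case unit
  have "mon_span V UNIV = A" by (auto simp: mon_span_def carrier)
  then show ?case using regular_unit[OF esym_list_closed] by simp
next
  case (prime W)
  then show ?case by (rule regular_prime)
next
  case (split x \<C>)
  show ?case
    by (rule regular_split[OF is_ideal_mon_span[OF split.hyps(2)] pvar_closed[OF split.hyps(1)] esym_list_closed])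
      (simp_all only: colon_mon_span[OF split.hyps(1)] adjoin_mon_span[OF split.hyps(2,1)] split.IH)
qed

end

section \<open>Cover ideals and their quotients\<close>

context poly_subring
begin

abbreviation S :: "('v, 'k) mpoly ring" where "S \<equiv> poly_ring V"

lemma S_simps:
  "carrier S = A" "mult S = (*)" "one S = 1" "zero S = 0" "add S = (+)"
  by (simp_all add: poly_ring_def carrier)

lemma ring_ideal: "is_ideal I \<Longrightarrow> ideal I S"
proof -
  assume I: "is_ideal I"
  interpret S: cring S by (rule cring_poly_ring)
  have minus: "\<ominus>\<^bsub>S\<^esub> p = - p" if "p \<in> A" for p
    by (rule S.minus_equality) (use that in \<open>simp_all add: S_simps uminus_closed\<close>)
  show "ideal I S"
  proof (rule idealI)
    show "subgroup I (add_monoid S)"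
    proof
      fix p assume p: "p \<in> I"
      have "inv\<^bsub>add_monoid S\<^esub> p = - p"
        using minus is_idealD(1)[OF I p] by (simp add: a_inv_def)
      moreover have "- p \<in> I"
        using is_ideal_diff[OF I is_idealD(2)[OF I] p] by simp
      ultimately show "inv\<^bsub>add_monoid S\<^esub> p \<in> I" by simp
    qed (use is_idealD(1-3)[OF I] in \<open>auto simp: S_simps\<close>)
  qed (use is_idealD(4,5)[OF I] in \<open>auto simp: S_simps S.ring_axioms\<close>)
qed

text \<open>Translates the record ideal \<open>Idl\<close> into supports. For the inclusion of the
  monomial span, variables are added one at a time through \<open>adjoin_mon_span\<close>, while the
  generated ideal stays that of the full set \<open>W\<close>.\<close>

lemma genideal_pvar:
  assumes "W \<subseteq> V"
  shows "Idl\<^bsub>S\<^esub> (pvar ` W) = mon_span V (prime_fam W)"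
proof (rule equalityI)
  interpret S: cring S by (rule cring_poly_ring)
  have "pvar x \<in> mon_span V (prime_fam W)" if "x \<in> W" for x
    using that assms by (intro mon_spanI) (auto simp: pvar_def prime_fam_def)
  then show "Idl\<^bsub>S\<^esub> (pvar ` W) \<subseteq> mon_span V (prime_fam W)"
    by (intro S.genideal_minimal ring_ideal is_ideal_mon_span upset_prime_fam) auto
  interpret I: ideal "Idl\<^bsub>S\<^esub> (pvar ` W)" S
    by (rule S.genideal_ideal) (use assms pvar_closed in \<open>auto simp: S_simps\<close>)
  have gen: "pvar x \<in> Idl\<^bsub>S\<^esub> (pvar ` W)" if "x \<in> W" for x
    using that assms pvar_closed S.genideal_self[of "pvar ` W"] by (force simp: S_simps)
  have "mon_span V (prime_fam W') \<subseteq> Idl\<^bsub>S\<^esub> (pvar ` W)" if "finite W'" "W' \<subseteq> W" for W'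
    using that
  proof (induction W' rule: finite_induct)
    case empty
    have "p = 0" if "p \<in> mon_span V (prime_fam {})" for p :: "('v, 'k) mpoly"
      using mon_spanD(3)[OF that] by (auto simp: prime_fam_def simp flip: keys_eq_empty)
    then show ?case using I.zero_closed by (auto simp: S_simps)
  next
    case (insert x W')
    have "prime_fam (insert x W') = extend_fam (prime_fam W') x"
      by (auto simp: extend_fam_def prime_fam_def)
    moreover have "x \<in> V" using insert.prems assms by blast
    ultimately have eq: "mon_span V (prime_fam (insert x W')) = adjoin (mon_span V (prime_fam W')) (pvar x)"
      by (simp add: adjoin_mon_span upset_prime_fam)
    show ?case
    proof
      fix p :: "('v, 'k) mpoly" assume "p \<in> mon_span V (prime_fam (insert x W'))"
      then have "p \<in> adjoin (mon_span V (prime_fam W')) (pvar x)" by (simp only: eq)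
      then obtain i q where q: "p = i + pvar x * q" "i \<in> mon_span V (prime_fam W')" "q \<in> A"
        by (rule adjoinE)
      have "i \<in> Idl\<^bsub>S\<^esub> (pvar ` W)" using q(2) insert by blast
      moreover have "pvar x * q \<in> Idl\<^bsub>S\<^esub> (pvar ` W)"
        using I.I_r_closed[OF gen, of x q] q(3) insert.prems by (simp add: S_simps)
      ultimately show "p \<in> Idl\<^bsub>S\<^esub> (pvar ` W)"
        using I.a_closed q(1) by (simp add: S_simps)
    qed
  qed
  then show "mon_span V (prime_fam W) \<subseteq> Idl\<^bsub>S\<^esub> (pvar ` W)"
    using finite_subset[OF assms finite_vars] by blast
qed

lemma cover_ideal_eq:
  assumes "simple_graph V E"
  shows "cover_ideal V E = (mon_span V (vertex_covers E) :: ('v, 'k) mpoly set)"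
proof -
  have "Idl\<^bsub>S\<^esub> (pvar ` e) = mon_span V (prime_fam e)" if "e \<in> E" for e
    using assms that by (intro genideal_pvar) (simp add: simple_graph_def)
  then have "(cover_ideal V E :: ('v, 'k) mpoly set) = A \<inter> (\<Inter>e\<in>E. mon_span V (prime_fam e))"
    by (simp add: cover_ideal_def S_simps)
  also have "\<dots> = mon_span V (vertex_covers E)"
    by (auto simp: mon_span_def carrier prime_fam_def vertex_covers_def Int_commute)
  finally show ?thesis .
qed

lemma irrelevant_ideal_eq:
  "irrelevant_ideal V = (mon_span V (prime_fam V) :: ('v, 'k) mpoly set)"
  unfolding irrelevant_ideal_def by (rule genideal_pvar) simp

section \<open>Cosets of an ideal as elements of the quotient module\<close>

context
  fixes J :: "('v, 'k) mpoly set"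
  assumes J: "is_ideal J"
begin

lemma coset_eq: "J +>\<^bsub>S\<^esub> p = (\<lambda>j. j + p) ` J"
  by (auto simp: a_r_coset_def r_coset_def S_simps)

lemma coset_eq_iff:
  "J +>\<^bsub>S\<^esub> p = J +>\<^bsub>S\<^esub> q \<longleftrightarrow> p - q \<in> J"
proof
  assume "J +>\<^bsub>S\<^esub> p = J +>\<^bsub>S\<^esub> q"
  then have "0 + p \<in> (\<lambda>j. j + q) ` J"
    unfolding coset_eq using is_idealD(2)[OF J] by blast
  then show "p - q \<in> J" by auto
next
  assume pq: "p - q \<in> J"
  have "(\<lambda>j. j + p) ` J \<subseteq> (\<lambda>j. j + q) ` J" if "p - q \<in> J" for p q
  proof
    fix r assume "r \<in> (\<lambda>j. j + p) ` J"
    then obtain j where "j \<in> J" "r = (j + (p - q)) + q" by auto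
    then show "r \<in> (\<lambda>j. j + q) ` J" using is_idealD(3)[OF J _ that] by blast
  qed
  moreover have "q - p \<in> J"
    using is_ideal_diff[OF J is_idealD(2)[OF J] pq] by simp
  ultimately show "J +>\<^bsub>S\<^esub> p = J +>\<^bsub>S\<^esub> q"
    unfolding coset_eq using pq by blast
qed

abbreviation Q :: "(('v, 'k) mpoly, ('v, 'k) mpoly set) module" where
  "Q \<equiv> quotient_module S J"

lemma Q_carrier: "carrier Q = (\<lambda>p. J +>\<^bsub>S\<^esub> p) ` A"
  by (auto simp: quotient_module_def FactRing_def A_RCOSETS_def' S_simps)

lemma Q_zero: "\<zero>\<^bsub>Q\<^esub> = J +>\<^bsub>S\<^esub> 0"
  by (simp add: quotient_module_def FactRing_def coset_eq)

lemma Q_hom: "(+>\<^bsub>S\<^esub>) J \<in> ring_hom S (S Quot J)"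
  by (rule ideal.rcos_ring_hom[OF ring_ideal[OF J]])

lemma Q_add: "p \<in> A \<Longrightarrow> q \<in> A \<Longrightarrow> (J +>\<^bsub>S\<^esub> p) \<oplus>\<^bsub>Q\<^esub> (J +>\<^bsub>S\<^esub> q) = J +>\<^bsub>S\<^esub> (p + q)"
  using ring_hom_add[OF Q_hom, of p q] by (simp add: quotient_module_def S_simps)

lemma Q_smult: "p \<in> A \<Longrightarrow> q \<in> A \<Longrightarrow> p \<odot>\<^bsub>Q\<^esub> (J +>\<^bsub>S\<^esub> q) = J +>\<^bsub>S\<^esub> (p * q)"
  using ring_hom_mult[OF Q_hom, of p q] by (simp add: quotient_module_def S_simps)

lemma Q_abelian_monoid: "abelian_monoid Q"
proof -
  interpret module S Q
    by (rule cring.module_quotient_module[OF cring_poly_ring ring_ideal[OF J]])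
  show ?thesis by (rule abelian_monoid_axioms)
qed

end

end

section \<open>Stanley decompositions from interval partitions\<close>

text \<open>Additivity is asked for on a subset \<open>B\<close> only, because \<open>\<phi>\<close>
  is controlled only on a span of monomials or on the polynomial subring.\<close>

lemma finsum_additive:
  assumes "abelian_monoid M" and z: "\<phi> 0 = \<zero>\<^bsub>M\<^esub>"
    and add: "\<And>p q. p \<in> B \<Longrightarrow> q \<in> B \<Longrightarrow> \<phi> (p + q) = \<phi> p \<oplus>\<^bsub>M\<^esub> \<phi> q"
    and closed: "(0 :: 'a::comm_monoid_add) \<in> B" "\<And>p q. p \<in> B \<Longrightarrow> q \<in> B \<Longrightarrow> p + q \<in> B"
      "\<And>p. p \<in> B \<Longrightarrow> \<phi> p \<in> carrier M"
    and X: "finite X" "\<And>i. i \<in> X \<Longrightarrow> f i \<in> B"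
  shows "(\<Oplus>\<^bsub>M\<^esub>i\<in>X. \<phi> (f i)) = \<phi> (\<Sum>i\<in>X. f i)"
proof -
  interpret abelian_monoid M by fact
  have "(\<Oplus>\<^bsub>M\<^esub>i\<in>X. \<phi> (f i)) = \<phi> (\<Sum>i\<in>X. f i) \<and> (\<Sum>i\<in>X. f i) \<in> B"
    using X
  proof (induction X rule: finite_induct)
    case empty
    then show ?case using z closed(1) by simp
  next
    case (insert x X)
    then have "(\<Oplus>\<^bsub>M\<^esub>i\<in>insert x X. \<phi> (f i)) = \<phi> (f x) \<oplus>\<^bsub>M\<^esub> (\<Oplus>\<^bsub>M\<^esub>i\<in>X. \<phi> (f i))"
      by (intro finsum_insert) (auto intro: closed(3))
    then show ?case using insert add closed(2) by simp
  qed
  then show ?thesis ..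
qed

lemma sqfree_mon_inj:
  assumes "finite C" "finite D" "sqfree_mon C = (sqfree_mon D :: ('v, 'k::field) mpoly)"
  shows "C = D"
proof -
  have "Poly_Mapping.keys (sqfree_mon C :: ('v, 'k) mpoly) = {sqfree_exp C}"
    "Poly_Mapping.keys (sqfree_mon D :: ('v, 'k) mpoly) = {sqfree_exp D}"
    by (simp_all add: sqfree_mon_def)
  then have "sqfree_exp C = sqfree_exp D" using assms(3) by simp
  then show ?thesis using keys_sqfree_exp assms(1,2) by metis
qed

lemma sqfree_mon_poly_component:
  assumes "finite C" "C \<subseteq> V"
  shows "sqfree_mon C \<in> poly_component V (\<lambda>x. int (Poly_Mapping.lookup (sqfree_exp C) x))"
  using sqfree_mon_polys_in[OF assms] by (simp add: poly_component_def sqfree_mon_def)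

text \<open>The map \<open>\<phi>\<close> makes one proof serve \<open>J\<close> (identity) and
  \<open>S/J\<close> (coset map on normal forms). For \<open>S/J\<close> the product
  \<open>v * sqfree_mon C\<close> may leave \<open>mon_span V \<F>\<close>, so \<open>smult\<close>
  speaks about \<open>\<phi>\<close> outside the bijection; in the decomposition \<open>v\<close>
  uses only variables in the top of the interval, and the product stays inside.\<close>

lemma sdepth_ge_partition:
  fixes M :: "(('v, 'k::field) mpoly, 'm) module" and \<phi> :: "('v, 'k) mpoly \<Rightarrow> 'm"
  assumes V: "finite V" and part: "has_partition V d \<F>" and M: "abelian_monoid M"
    and bij: "bij_betw \<phi> (mon_span V \<F>) (carrier M)"
    and zero: "\<phi> 0 = \<zero>\<^bsub>M\<^esub>"
    and add: "\<And>p q. p \<in> mon_span V \<F> \<Longrightarrow> q \<in> mon_span V \<F> \<Longrightarrow> \<phi> (p + q) = \<phi> p \<oplus>\<^bsub>M\<^esub> \<phi> q"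
    and smult: "\<And>v C. v \<in> polys_in V \<Longrightarrow> C \<subseteq> V \<Longrightarrow> C \<in> \<F> \<Longrightarrow>
      v \<odot>\<^bsub>M\<^esub> \<phi> (sqfree_mon C) = \<phi> (v * sqfree_mon C)"
    and homog: "\<And>C. C \<subseteq> V \<Longrightarrow> C \<in> \<F> \<Longrightarrow> \<exists>a. \<phi> (sqfree_mon C) \<in> Gr a"
  shows "enat d \<le> sdepth V Gr M"
proof -
  interpret abelian_monoid M by fact
  obtain P where P: "\<And>p. p \<in> P \<Longrightarrow> fst p \<subseteq> snd p" "\<And>p. p \<in> P \<Longrightarrow> snd p \<subseteq> V"
    "\<And>p. p \<in> P \<Longrightarrow> d \<le> card (snd p)" "(\<Union>p\<in>P. {fst p..snd p}) = \<F>"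
    "\<And>p q A. p \<in> P \<Longrightarrow> q \<in> P \<Longrightarrow> fst p \<subseteq> A \<Longrightarrow> A \<subseteq> snd p \<Longrightarrow> fst q \<subseteq> A \<Longrightarrow> A \<subseteq> snd q \<Longrightarrow> p = q"
    using part by (rule has_partitionE) (rule that)
  have finite_fst: "finite (fst p)" "fst p \<subseteq> V" "fst p \<in> \<F>" if "p \<in> P" for p
  proof -
    show sub: "fst p \<subseteq> V" using P(1,2)[OF that] by blast
    show "finite (fst p)" using V sub by (rule rev_finite_subset)
    have "fst p \<in> {fst p..snd p}" using P(1)[OF that] by simp
    then show "fst p \<in> \<F>" unfolding P(4)[symmetric] using that by blast
  qed
  have "P \<subseteq> Pow V \<times> Pow V"
    by (rule subsetI) (simp add: mem_Times_iff finite_fst(2) P(2))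
  then have finP: "finite P" by (rule finite_subset) (simp add: V)
  have inj: "inj_on \<phi> (mon_span V \<F>)" and im: "\<phi> ` mon_span V \<F> = carrier M"
    using bij by (auto simp: bij_betw_def)

  define g where "g p = (\<phi> (sqfree_mon (fst p)), snd p)" for p :: "'v set \<times> 'v set"
  \<comment> \<open>The exponents in the Stanley space of an interval. For the intervals of
    \<open>P\<close> these sets are disjoint and contain all exponents with support in
    \<open>\<F>\<close>, so components are obtained by \<open>restrict_keys\<close>.\<close>
  define cone where "cone p = {m :: 'v \<Rightarrow>\<^sub>0 nat. Poly_Mapping.keys m \<in> {fst p..snd p}}"
    for p :: "'v set \<times> 'v set"
  define T where "T p = (mon_span (snd p) {fst p..snd p} :: ('v, 'k) mpoly set)"
    for p :: "'v set \<times> 'v set"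
  have T_sub: "q \<in> mon_span V \<F>" if "q \<in> T p" "p \<in> P" for p q
  proof (rule mon_spanI)
    fix m assume "m \<in> Poly_Mapping.keys q"
    then have m: "Poly_Mapping.keys m \<in> {fst p..snd p}"
      using mon_spanD(3) that(1) unfolding T_def by blast
    then have "Poly_Mapping.keys m \<in> (\<Union>p\<in>P. {fst p..snd p})" using that(2) by blast
    moreover have "Poly_Mapping.keys m \<subseteq> V" using m P(2)[OF that(2)] by auto
    ultimately show "Poly_Mapping.keys m \<subseteq> V \<and> Poly_Mapping.keys m \<in> \<F>" by (simp only: P(4))
  qed
  have T_cone: "Poly_Mapping.keys q \<subseteq> cone p" if "q \<in> T p" for p q
    using mon_spanD(3) that unfolding T_def cone_def by blast
  have restrict_T: "restrict_keys (cone p) q \<in> T p" for p q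
    unfolding T_def by (rule mon_spanI) (auto simp: keys_restrict_keys cone_def)
  have cone_disj: "cone p \<inter> cone p' = {}" if "p \<in> P" "p' \<in> P" "p \<noteq> p'" for p p'
    using P(5)[OF that(1,2)] that(3) by (auto simp: cone_def)
  have mon_T: "sqfree_mon (fst p) \<in> T p" if "p \<in> P" for p
    unfolding T_def using P(1)[OF that] finite_fst[OF that]
    by (intro mon_spanI) (simp add: sqfree_mon_def keys_sqfree_exp)
  have polys_V: "v \<in> polys_in V" if "v \<in> polys_in (snd p)" "p \<in> P" for v :: "('v, 'k) mpoly" and p
    using that P(2)[OF that(2)] by (auto simp: polys_in_def)
  have times_T: "v * sqfree_mon (fst p) \<in> T p" if "v \<in> polys_in (snd p)" "p \<in> P" for v p
    using sqfree_mon_times_polys_in[OF finite_fst(1) P(1), OF that(2,2)] that(1)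
    unfolding T_def by blast
  have st: "stanley_set M (fst (g p)) (snd (g p)) = \<phi> ` T p" if p: "p \<in> P" for p
  proof -
    have "stanley_set M (fst (g p)) (snd (g p)) = {\<phi> (v * sqfree_mon (fst p)) | v. v \<in> polys_in (snd p)}"
      using smult[OF polys_V[OF _ p] finite_fst(2,3)[OF p]]
      unfolding stanley_set_def g_def fst_conv snd_conv by metis
    also have "\<dots> = \<phi> ` {v * sqfree_mon (fst p) | v. v \<in> polys_in (snd p)}" by blast
    also have "\<dots> = \<phi> ` T p"
      by (simp only: T_def sqfree_mon_times_polys_in[OF finite_fst(1) P(1), OF p p])
    finally show ?thesis .
  qed
  \<comment> \<open>A decomposition is a set of pairs, so distinct intervals must give distinct
    pairs before sums can be reindexed by \<open>P\<close>.\<close>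
  have g_inj: "inj_on g P"
  proof (rule inj_onI)
    fix p q assume pq: "p \<in> P" "q \<in> P" "g p = g q"
    then have "sqfree_mon (fst p) = (sqfree_mon (fst q) :: ('v, 'k) mpoly)"
      using T_sub[OF mon_T] by (intro inj_onD[OF inj]) (auto simp: g_def)
    then have "fst p = fst q" using sqfree_mon_inj finite_fst(1) pq by blast
    then show "p = q" using pq(3) by (simp add: g_def prod_eq_iff)
  qed
  have space: "is_stanley_space V Gr M (fst (g p)) (snd (g p))" if p: "p \<in> P" for p
    unfolding is_stanley_space_def
  proof (intro conjI ballI impI)
    show "\<exists>a. fst (g p) \<in> Gr a" using homog[OF finite_fst(2,3)[OF p]] by (simp add: g_def)
    show "snd (g p) \<subseteq> V" using P(2)[OF p] by (simp add: g_def)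
    fix v :: "('v, 'k) mpoly" assume v: "v \<in> polys_in (snd (g p))" "v \<odot>\<^bsub>M\<^esub> fst (g p) = \<zero>\<^bsub>M\<^esub>"
    have v': "v \<in> polys_in (snd p)" using v(1) by (simp add: g_def)
    have "\<phi> (v * sqfree_mon (fst p)) = \<phi> 0"
      using smult[OF polys_V[OF v' p] finite_fst(2,3)[OF p]] v(2) zero by (simp add: g_def)
    then have "v * sqfree_mon (fst p) = 0"
      using inj_onD[OF inj _ T_sub[OF times_T[OF v' p] p] mon_span_zero] by blast
    then show "v = 0" by (simp add: sqfree_mon_def mult.commute[of v] single_times_eq_0_iff)
  qed

  have finsum_g: "(\<Oplus>\<^bsub>M\<^esub>e\<in>g ` P. w e) = \<phi> (\<Sum>p\<in>P. r p)"
    if r: "\<And>p. p \<in> P \<Longrightarrow> r p \<in> mon_span V \<F>" "\<And>p. p \<in> P \<Longrightarrow> w (g p) = \<phi> (r p)" for w r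
  proof -
    have c: "\<phi> q \<in> carrier M" if "q \<in> mon_span V \<F>" for q using im that by blast
    have "(\<Oplus>\<^bsub>M\<^esub>e\<in>g ` P. w e) = (\<Oplus>\<^bsub>M\<^esub>p\<in>P. w (g p))"
      by (rule finsum_reindex[OF _ g_inj]) (use r c in auto)
    also have "\<dots> = (\<Oplus>\<^bsub>M\<^esub>p\<in>P. \<phi> (r p))"
      by (rule finsum_cong') (use r c in auto)
    also have "\<dots> = \<phi> (\<Sum>p\<in>P. r p)"
      by (rule finsum_additive[OF M zero add _ _ _ finP])
        (use r(1) c in \<open>auto intro: mon_span_zero mon_span_add\<close>)
    finally show ?thesis .
  qed
  have decomp: "\<exists>!w. w \<in> (\<Pi>\<^sub>E (u, Z)\<in>g ` P. stanley_set M u Z) \<and> x = (\<Oplus>\<^bsub>M\<^esub>e\<in>g ` P. w e)"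
    if x: "x \<in> carrier M" for x
  proof -
    obtain q where q: "q \<in> mon_span V \<F>" "x = \<phi> q" using x im by blast
    \<comment> \<open>The restricted lambda makes \<open>w\<close> extensional, as
      \<open>\<Pi>\<^sub>E\<close> demands.\<close>
    define w where "w = (\<lambda>e\<in>g ` P. \<phi> (restrict_keys (cone (inv_into P g e)) q))"
    have w: "w (g p) = \<phi> (restrict_keys (cone p) q)" if "p \<in> P" for p
      using that g_inj by (simp add: w_def)
    have "Poly_Mapping.keys q \<subseteq> (\<Union>p\<in>P. cone p)"
    proof
      fix m assume "m \<in> Poly_Mapping.keys q"
      then have "Poly_Mapping.keys m \<in> (\<Union>p\<in>P. {fst p..snd p})"
        unfolding P(4) by (rule mon_spanD(3)[OF q(1)])
      then show "m \<in> (\<Union>p\<in>P. cone p)" unfolding cone_def by blast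
    qed
    then have sum_q: "(\<Sum>p\<in>P. restrict_keys (cone p) q) = q"
      by (intro sum_restrict_keys finP cone_disj)
    have w_PiE: "w \<in> (\<Pi>\<^sub>E (u, Z)\<in>g ` P. stanley_set M u Z)"
    proof (rule PiE_I)
      fix e assume "e \<in> g ` P"
      then obtain p where p: "p \<in> P" "e = g p" by blast
      have "w e \<in> \<phi> ` T p" using w[OF p(1)] restrict_T p(2) by simp
      then show "w e \<in> (case e of (u, Z) \<Rightarrow> stanley_set M u Z)"
        using st[OF p(1)] p(2) by (simp add: case_prod_beta)
    qed (simp add: w_def)
    show ?thesis
    proof (rule ex1I[of _ w], intro conjI)
      show "w \<in> (\<Pi>\<^sub>E (u, Z)\<in>g ` P. stanley_set M u Z)" by (rule w_PiE)
      show "x = (\<Oplus>\<^bsub>M\<^esub>e\<in>g ` P. w e)"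
        using finsum_g[of "\<lambda>p. restrict_keys (cone p) q" w] w T_sub[OF restrict_T] q(2) sum_q by simp
    next
      fix w' assume w': "w' \<in> (\<Pi>\<^sub>E (u, Z)\<in>g ` P. stanley_set M u Z) \<and> x = (\<Oplus>\<^bsub>M\<^esub>e\<in>g ` P. w' e)"
      have "\<exists>r. r \<in> T p \<and> w' (g p) = \<phi> r" if p: "p \<in> P" for p
      proof -
        have "w' (g p) \<in> (case g p of (u, Z) \<Rightarrow> stanley_set M u Z)"
          using w' p by (intro PiE_mem[of w' "g ` P"]) auto
        then show ?thesis using st[OF p] by (auto simp: case_prod_beta)
      qed
      then obtain r where r: "\<And>p. p \<in> P \<Longrightarrow> r p \<in> T p" "\<And>p. p \<in> P \<Longrightarrow> w' (g p) = \<phi> (r p)"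
        by metis
      have rB: "r p \<in> mon_span V \<F>" if "p \<in> P" for p
        by (rule T_sub[OF r(1)[OF that] that])
      have "\<phi> q = \<phi> (\<Sum>p\<in>P. r p)"
        using finsum_g[of r w', OF rB r(2)] w' q(2) by simp
      then have q_sum: "q = (\<Sum>p\<in>P. r p)"
        by (rule inj_onD[OF inj _ q(1) mon_span_sum[OF rB]])
      \<comment> \<open>Uniqueness: projecting \<open>q\<close> to the cone of \<open>p\<close>
        kills the summands of all other intervals.\<close>
      have rp: "r p = restrict_keys (cone p) q" if p: "p \<in> P" for p
      proof -
        have "restrict_keys (cone p) (r p') = (if p' = p then r p' else 0)" if p': "p' \<in> P" for p'
          using T_cone[OF r(1)[OF p']] cone_disj[OF p p']
          by (auto intro!: restrict_keys_idem restrict_keys_eq_0)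
        then have "restrict_keys (cone p) q = (\<Sum>p'\<in>P. if p' = p then r p' else 0)"
          unfolding q_sum restrict_keys_sum by (intro sum.cong) auto
        then show ?thesis using p finP by simp
      qed
      show "w' = w"
      proof (rule PiE_ext[where k = "g ` P" and s = "\<lambda>(u, Z). stanley_set M u Z"])
        show "w \<in> (\<Pi>\<^sub>E (u, Z)\<in>g ` P. stanley_set M u Z)" by (rule w_PiE)
        show "w' e = w e" if "e \<in> g ` P" for e
          using that r(2) w rp by auto
      qed (use w' in simp)
    qed
  qed
  have "stanley_decomposition V Gr M (g ` P)"
    unfolding stanley_decomposition_def using finP space decomp by (auto simp: case_prod_beta)
  moreover have "enat d \<le> sdepth_decomposition (g ` P)"
    unfolding sdepth_decomposition_def
  proof (rule INF_greatest)
    fix e assume "e \<in> g ` P"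
    then obtain p where "p \<in> P" "e = g p" by blast
    then show "enat d \<le> (case e of (u, Z) \<Rightarrow> enat (card Z))" using P(3) by (simp add: g_def)
  qed
  ultimately show ?thesis
    unfolding sdepth_def by (intro SUP_upper2) auto
qed

section \<open>Stanley depth of a squarefree monomial ideal and of its quotient\<close>

context poly_subring
begin

lemma sdepth_mon_span:
  assumes up: "upset \<C>" and part: "has_partition V d (Pow V \<inter> \<C>)"
  shows "enat d \<le> sdepth V (ideal_component V (mon_span V \<C>)) (ideal_module S (mon_span V \<C>))"
proof -
  let ?J = "mon_span V \<C> :: ('v, 'k) mpoly set"
  interpret module S "ideal_module S ?J"
    by (rule cring.module_ideal_module[OF cring_poly_ring ring_ideal[OF is_ideal_mon_span[OF up]]])
  have eq: "mon_span V (Pow V \<inter> \<C>) = ?J" by (auto simp: mon_span_def polys_in_def)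
  show ?thesis
  proof (rule sdepth_ge_partition[OF finite_vars part abelian_monoid_axioms, where \<phi> = "\<lambda>p. p"])
    fix C assume C: "C \<subseteq> V" "C \<in> Pow V \<inter> \<C>"
    have "finite C" using C(1) finite_vars by (rule finite_subset)
    then show "\<exists>a. sqfree_mon C \<in> ideal_component V ?J a"
      using sqfree_mon_poly_component[OF \<open>finite C\<close> C(1)] C
      by (intro exI[of _ "\<lambda>x. int (Poly_Mapping.lookup (sqfree_exp C) x)"])
        (auto simp: ideal_component_def sqfree_mon_def keys_sqfree_exp intro!: mon_spanI)
  qed (simp_all add: eq bij_betw_def ideal_module_def S_simps)
qed

text \<open>The monomials with support outside \<open>\<C>\<close> give a basis of the quotient: a
  nonzero combination of them is not in the ideal, and every polynomial is congruent to its part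
  supported outside \<open>\<C>\<close>.\<close>

lemma sdepth_quotient_mon_span:
  assumes up: "upset \<C>" and part: "has_partition V d (Pow V - \<C>)"
  shows "enat d \<le> sdepth V (quotient_component V (mon_span V \<C>)) (quotient_module S (mon_span V \<C>))"
proof -
  let ?J = "mon_span V \<C> :: ('v, 'k) mpoly set" and ?F = "Pow V - \<C>"
  note J = is_ideal_mon_span[OF up]
  have sub: "mon_span V ?F \<subseteq> A" unfolding carrier by (rule mon_span_subset)
  have mon: "sqfree_mon C \<in> A" if "C \<subseteq> V" for C
    unfolding carrier using that finite_subset[OF that finite_vars] by (intro sqfree_mon_polys_in)
  show ?thesis
  proof (rule sdepth_ge_partition[OF finite_vars part Q_abelian_monoid[OF J],
        where \<phi> = "\<lambda>p. ?J +>\<^bsub>S\<^esub> p"])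
    show "bij_betw (\<lambda>p. ?J +>\<^bsub>S\<^esub> p) (mon_span V ?F) (carrier (quotient_module S ?J))"
      unfolding bij_betw_def
    proof
      show "inj_on (\<lambda>p. ?J +>\<^bsub>S\<^esub> p) (mon_span V ?F)"
      proof (rule inj_onI)
        fix p q :: "('v, 'k) mpoly" assume p: "p \<in> mon_span V ?F" and q: "q \<in> mon_span V ?F"
          and "?J +>\<^bsub>S\<^esub> p = ?J +>\<^bsub>S\<^esub> q"
        then have "p - q \<in> ?J" using coset_eq_iff[OF J] by simp
        moreover have "p - q \<in> mon_span V ?F"
          using mon_span_add[OF p mon_span_uminus[OF q]] by simp
        ultimately have "m \<notin> Poly_Mapping.keys (p - q)" for m
          using mon_spanD(3) by blast
        then have "Poly_Mapping.keys (p - q) = {}" by blast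
        then show "p = q" by simp
      qed
      have "\<exists>q\<in>mon_span V ?F. ?J +>\<^bsub>S\<^esub> p = ?J +>\<^bsub>S\<^esub> q" if p: "p \<in> A" for p
      proof
        let ?X = "{m. Poly_Mapping.keys m \<notin> \<C>}"
        have keys: "Poly_Mapping.keys m \<subseteq> V" if "m \<in> Poly_Mapping.keys p" for m
          using p that by (auto simp: carrier polys_in_def)
        show "restrict_keys ?X p \<in> mon_span V ?F"
          using keys by (intro mon_spanI) (auto simp: keys_restrict_keys)
        have "p - restrict_keys ?X p = restrict_keys (- ?X) p"
          using restrict_keys_partition[of p ?X] by (simp add: diff_eq_eq add.commute)
        also have "\<dots> \<in> ?J"
          using keys by (intro mon_spanI) (auto simp: keys_restrict_keys)
        finally show "?J +>\<^bsub>S\<^esub> p = ?J +>\<^bsub>S\<^esub> restrict_keys ?X p"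
          using coset_eq_iff[OF J] by simp
      qed
      then show "(\<lambda>p. ?J +>\<^bsub>S\<^esub> p) ` mon_span V ?F = carrier (quotient_module S ?J)"
        unfolding Q_carrier[OF J] using sub by blast
    qed
    show "?J +>\<^bsub>S\<^esub> 0 = \<zero>\<^bsub>quotient_module S ?J\<^esub>" by (simp add: Q_zero[OF J])
    show "?J +>\<^bsub>S\<^esub> (p + q) = (?J +>\<^bsub>S\<^esub> p) \<oplus>\<^bsub>quotient_module S ?J\<^esub> (?J +>\<^bsub>S\<^esub> q)"
      if "p \<in> mon_span V ?F" "q \<in> mon_span V ?F" for p q
      using that sub by (intro Q_add[OF J, symmetric]) auto
    show "v \<odot>\<^bsub>quotient_module S ?J\<^esub> (?J +>\<^bsub>S\<^esub> sqfree_mon C) = ?J +>\<^bsub>S\<^esub> (v * sqfree_mon C)"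
      if "v \<in> polys_in V" "C \<subseteq> V" for v C
      using that mon by (intro Q_smult[OF J]) (auto simp: carrier)
    show "\<exists>a. ?J +>\<^bsub>S\<^esub> sqfree_mon C \<in> quotient_component V ?J a" if "C \<subseteq> V" for C
      unfolding quotient_component_def
      using sqfree_mon_poly_component[OF finite_subset[OF that finite_vars] that] by blast
  qed
qed

section \<open>Depth from regular sequences modulo an ideal\<close>

text \<open>Puts the iterated \<open>adjoin\<close> into the shape of
  \<open>list_times_module\<close>, where all coefficients are chosen at once.\<close>

lemma foldl_adjoin_eq:
  assumes "set fs \<subseteq> A"
  shows "foldl adjoin I fs = {i + (\<Sum>j<length fs. fs ! j * q j) | i q. i \<in> I \<and> q \<in> {..<length fs} \<rightarrow> A}"
  using assms
proof (induction fs rule: rev_induct)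
  case Nil
  then show ?case by auto
next
  case (snoc f fs)
  let ?n = "length fs"
  have eq: "(\<Sum>j<length (fs @ [f]). (fs @ [f]) ! j * q j) = (\<Sum>j<?n. fs ! j * q j) + f * q ?n" for q
    by (simp add: nth_append)
  show ?case
  proof (intro equalityI subsetI)
    fix p assume "p \<in> foldl adjoin I (fs @ [f])"
    then have "p \<in> adjoin (foldl adjoin I fs) f" by simp
    then obtain p' r where r: "p = p' + f * r" "p' \<in> foldl adjoin I fs" "r \<in> A" by (rule adjoinE)
    then obtain i q where q: "p' = i + (\<Sum>j<?n. fs ! j * q j)" "i \<in> I" "q \<in> {..<?n} \<rightarrow> A"
      using snoc by auto
    have "p = i + (\<Sum>j<length (fs @ [f]). (fs @ [f]) ! j * (q(?n := r)) j)"
      unfolding eq r(1) q(1) by simp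
    moreover have "q(?n := r) \<in> {..<length (fs @ [f])} \<rightarrow> A"
      using q(3) r(3) by (auto simp: less_Suc_eq)
    ultimately show "p \<in> {i + (\<Sum>j<length (fs @ [f]). (fs @ [f]) ! j * q j) | i q.
        i \<in> I \<and> q \<in> {..<length (fs @ [f])} \<rightarrow> A}" using q(2) by blast
  next
    fix p assume "p \<in> {i + (\<Sum>j<length (fs @ [f]). (fs @ [f]) ! j * q j) | i q.
        i \<in> I \<and> q \<in> {..<length (fs @ [f])} \<rightarrow> A}"
    then obtain i q where q: "p = i + (\<Sum>j<?n. fs ! j * q j) + f * q ?n" "i \<in> I"
      "q \<in> {..<length (fs @ [f])} \<rightarrow> A"
      unfolding eq by (auto simp: add.assoc)
    have "q \<in> {..<?n} \<rightarrow> A" using q(3) by (auto simp: Pi_iff)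
    moreover have "foldl adjoin I fs =
        {i + (\<Sum>j<?n. fs ! j * q j) | i q. i \<in> I \<and> q \<in> {..<?n} \<rightarrow> A}"
      using snoc.prems by (intro snoc.IH) simp
    ultimately have "i + (\<Sum>j<?n. fs ! j * q j) \<in> foldl adjoin I fs"
      using q(2) by blast
    then show "p \<in> foldl adjoin I (fs @ [f])"
      unfolding q(1) foldl_append foldl_Cons foldl_Nil using q(3) by (intro adjoinI) auto
  qed
qed

lemma foldl_adjoin_least:
  assumes "is_ideal K" "I \<subseteq> K" "set fs \<subseteq> K"
  shows "foldl adjoin I fs \<subseteq> K"
  using assms(2,3)
proof (induction fs arbitrary: I)
  case (Cons f fs)
  have "adjoin I f \<subseteq> K"
    using Cons.prems is_idealD(3,4)[OF assms(1)] by (auto elim!: adjoinE)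
  then show ?case using Cons by simp
qed simp

lemma list_times_quotient_iff:
  assumes J: "is_ideal J" and fs: "set fs \<subseteq> A" and p: "p \<in> A"
  shows "J +>\<^bsub>S\<^esub> p \<in> list_times_module fs (quotient_module S J) \<longleftrightarrow> p \<in> foldl adjoin J fs"
proof -
  let ?Q = "quotient_module S J" and ?n = "length fs"
  have fs': "fs ! j \<in> A" if "j < ?n" for j using fs that by auto
  have sum: "(\<Oplus>\<^bsub>?Q\<^esub>j\<in>{..<?n}. fs ! j \<odot>\<^bsub>?Q\<^esub> w j) = J +>\<^bsub>S\<^esub> (\<Sum>j<?n. fs ! j * q j)"
    if q: "\<And>j. j < ?n \<Longrightarrow> q j \<in> A" "\<And>j. j < ?n \<Longrightarrow> w j = J +>\<^bsub>S\<^esub> q j" for w q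
  proof -
    interpret abelian_monoid ?Q by (rule Q_abelian_monoid[OF J])
    have "(\<Oplus>\<^bsub>?Q\<^esub>j\<in>{..<?n}. fs ! j \<odot>\<^bsub>?Q\<^esub> w j) = (\<Oplus>\<^bsub>?Q\<^esub>j\<in>{..<?n}. J +>\<^bsub>S\<^esub> (fs ! j * q j))"
      by (rule finsum_cong') (use q fs' in \<open>auto simp: Q_smult[OF J] Q_carrier[OF J] times_closed\<close>)
    also have "\<dots> = J +>\<^bsub>S\<^esub> (\<Sum>j<?n. fs ! j * q j)"
      by (rule finsum_additive[where M = ?Q and B = A and \<phi> = "\<lambda>p. J +>\<^bsub>S\<^esub> p"])
        (use q fs' in \<open>auto simp: Q_add[OF J] Q_zero[OF J] Q_carrier[OF J] abelian_monoid_axioms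
            is_idealD(2)[OF is_ideal_unit] add_closed times_closed\<close>)
    finally show ?thesis .
  qed
  have sum_A: "(\<Sum>j<?n. fs ! j * q j) \<in> foldl adjoin J fs" if "q \<in> {..<?n} \<rightarrow> A" for q
    unfolding foldl_adjoin_eq[OF fs] using that is_idealD(2)[OF J] by force
  have K: "is_ideal (foldl adjoin J fs)" by (rule is_ideal_foldl_adjoin[OF J fs])
  show ?thesis
  proof
    assume "J +>\<^bsub>S\<^esub> p \<in> list_times_module fs ?Q"
    then obtain w where w: "J +>\<^bsub>S\<^esub> p = (\<Oplus>\<^bsub>?Q\<^esub>j\<in>{..<?n}. fs ! j \<odot>\<^bsub>?Q\<^esub> w j)"
      "w \<in> {..<?n} \<rightarrow> carrier ?Q"
      unfolding list_times_module_def by blast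
    have "\<exists>q. q \<in> A \<and> w j = J +>\<^bsub>S\<^esub> q" if "j < ?n" for j
      using w(2) that unfolding Q_carrier[OF J] by blast
    then obtain q where q: "\<And>j. j < ?n \<Longrightarrow> q j \<in> A" "\<And>j. j < ?n \<Longrightarrow> w j = J +>\<^bsub>S\<^esub> q j"
      by metis
    have "p - (\<Sum>j<?n. fs ! j * q j) \<in> J"
      using w(1) sum[OF q] coset_eq_iff[OF J] by simp
    then have "(p - (\<Sum>j<?n. fs ! j * q j)) + (\<Sum>j<?n. fs ! j * q j) \<in> foldl adjoin J fs"
      using foldl_adjoin_superset[of J fs] sum_A q(1) by (intro is_idealD(3)[OF K]) auto
    then show "p \<in> foldl adjoin J fs" by simp
  next
    assume "p \<in> foldl adjoin J fs"
    then obtain i q where q: "p = i + (\<Sum>j<?n. fs ! j * q j)" "i \<in> J" "q \<in> {..<?n} \<rightarrow> A"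
      unfolding foldl_adjoin_eq[OF fs] by blast
    have "J +>\<^bsub>S\<^esub> p = J +>\<^bsub>S\<^esub> (\<Sum>j<?n. fs ! j * q j)"
      using q(1,2) by (simp add: coset_eq_iff[OF J])
    also have "\<dots> = (\<Oplus>\<^bsub>?Q\<^esub>j\<in>{..<?n}. fs ! j \<odot>\<^bsub>?Q\<^esub> (J +>\<^bsub>S\<^esub> q j))"
      using q(3) by (intro sum[symmetric]) auto
    finally show "J +>\<^bsub>S\<^esub> p \<in> list_times_module fs ?Q"
      unfolding list_times_module_def Q_carrier[OF J] using q(3)
      by (intro CollectI exI[of _ "\<lambda>j. J +>\<^bsub>S\<^esub> q j"]) auto
  qed
qed

lemma depth_ge_length:
  assumes "regular_sequence M fs" "set fs \<subseteq> I"
  shows "enat (length fs) \<le> depth I M"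
proof -
  have "enat (length fs) \<le> (SUP fs\<in>{fs. set fs \<subseteq> I \<and> regular_sequence M fs}. enat (length fs))"
    using assms by (intro SUP_upper) simp
  then show ?thesis by (simp add: depth_def)
qed

text \<open>\<open>K\<close> witnesses that the quotient by the sequence is nonzero: it contains
  \<open>J\<close> and all of \<open>fs\<close> but not 1. It will be the irrelevant ideal.\<close>

lemma regular_sequence_quotient:
  assumes J: "is_ideal J" and fs: "set fs \<subseteq> A" "regular J fs"
    and K: "is_ideal K" "J \<subseteq> K" "set fs \<subseteq> K" "1 \<notin> K"
  shows "regular_sequence (quotient_module S J) fs"
  unfolding regular_sequence_def
proof (intro conjI allI impI ballI)
  let ?Q = "quotient_module S J"
  fix i x assume i: "i < length fs" and x: "x \<in> carrier ?Q"
    and fx: "fs ! i \<odot>\<^bsub>?Q\<^esub> x \<in> list_times_module (take i fs) ?Q"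
  have take: "set (take i fs) \<subseteq> A" using fs(1) set_take_subset by (rule order_trans[rotated])
  obtain p where p: "p \<in> A" "x = J +>\<^bsub>S\<^esub> p" using x unfolding Q_carrier[OF J] by blast
  have f: "fs ! i \<in> A" using fs(1) nth_mem[OF i] by blast
  have "fs ! i * p \<in> foldl adjoin J (take i fs)"
    using fx list_times_quotient_iff[OF J take times_closed[OF f p(1)]]
    by (simp only: p(2) Q_smult[OF J f p(1)])
  then have "p \<in> foldl adjoin J (take i fs)"
    using regular_nth[OF fs(2) i] p(1) by (simp only: nonzerodivisor_def)
  then show "x \<in> list_times_module (take i fs) ?Q"
    using list_times_quotient_iff[OF J take p(1)] p(2) by simp
next
  have "foldl adjoin J fs \<subseteq> K" by (rule foldl_adjoin_least[OF K(1-3)])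
  then have "J +>\<^bsub>S\<^esub> 1 \<notin> list_times_module fs (quotient_module S J)"
    using list_times_quotient_iff[OF J fs(1) one_closed] K(4) by blast
  moreover have "J +>\<^bsub>S\<^esub> 1 \<in> carrier (quotient_module S J)"
    unfolding Q_carrier[OF J] using one_closed by blast
  ultimately show "list_times_module fs (quotient_module S J) \<noteq> carrier (quotient_module S J)"
    by metis
qed

text \<open>Degree 0 is excluded because \<open>esym 0\<close> is 1; for this reason the sequences
  start at \<open>esym 1\<close>.\<close>

lemma esym_irrelevant:
  assumes "1 \<le> k"
  shows "esym k \<in> mon_span V (prime_fam V)"
proof (rule mon_spanI)
  fix m assume m: "m \<in> Poly_Mapping.keys (esym k)"
  have sub: "Poly_Mapping.keys m \<subseteq> V"
    using esym_closed[of k] m by (auto simp: carrier polys_in_def)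
  have "total_degree m = k" using homogeneous_esym m by (simp add: homogeneous_def)
  then have "m \<noteq> 0" using assms by (auto simp: total_degree_def)
  then show "Poly_Mapping.keys m \<subseteq> V \<and> Poly_Mapping.keys m \<in> prime_fam V"
    using sub by (simp add: prime_fam_def Int_absorb2)
qed

lemma depth_quotient_split_fam:
  assumes split: "split_fam V d \<C>" and up: "upset \<C>" and proper: "{} \<notin> \<C>"
  shows "enat d \<le> depth (irrelevant_ideal V) (quotient_module S (mon_span V \<C>))"
proof -
  define fs where "fs = map esym [1..<Suc d]"
  have fs: "set fs \<subseteq> A" "length fs = d" "regular (mon_span V \<C>) fs"
    unfolding fs_def by (rule esym_list_closed) (simp_all only: length_map length_upt diff_Suc_1 regular_split_fam[OF split])
  have irr: "set fs \<subseteq> mon_span V (prime_fam V)"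
    unfolding fs_def set_map set_upt by (intro image_subsetI esym_irrelevant) simp
  have sub: "(mon_span V \<C> :: ('v, 'k) mpoly set) \<subseteq> mon_span V (prime_fam V)"
  proof (intro subsetI mon_spanI)
    fix p m assume p: "p \<in> (mon_span V \<C> :: ('v, 'k) mpoly set)" "m \<in> Poly_Mapping.keys p"
    have "Poly_Mapping.keys m \<noteq> {}" using mon_spanD(3)[OF p] proper by metis
    then show "Poly_Mapping.keys m \<subseteq> V \<and> Poly_Mapping.keys m \<in> prime_fam V"
      using mon_spanD(2)[OF p] by (simp add: prime_fam_def Int_absorb2)
  qed
  have "(1 :: ('v, 'k) mpoly) \<notin> mon_span V (prime_fam V)"
    by (simp add: mon_span_def prime_fam_def)
  then have "regular_sequence (quotient_module S (mon_span V \<C>)) fs"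
    by (rule regular_sequence_quotient[OF is_ideal_mon_span[OF up] fs(1,3)
        is_ideal_mon_span[OF upset_prime_fam] sub irr])
  from depth_ge_length[OF this] show ?thesis
    using irr fs(2) by (simp add: irrelevant_ideal_eq)
qed

end

theorem theorem2p4:
  fixes V :: "'v set" and E :: "'v set set"
    and S :: "('v, 'k::field) mpoly ring"
    and J :: "('v, 'k) mpoly set"
    and n :: nat
  assumes "simple_graph V E"
    and "n = card V"
    and "S = poly_ring V"
    and "J = cover_ideal V E"
  shows "(sdepth V (ideal_component V J) (ideal_module S J)
             \<ge> enat (n - ordered_matching_number E)
          \<and> sdepth V (quotient_component V J) (quotient_module S J)
             \<ge> enat (n - ordered_matching_number E - 1))
       \<and> depth (irrelevant_ideal V) (quotient_module S J)
             \<ge> enat (n - ordered_matching_number E - 1)"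
proof -
  interpret poly_subring "polys_in V :: ('v, 'k) mpoly set" V
    using assms(1)
    by unfold_locales (auto simp: simple_graph_def polys_in_zero_one polys_in_add polys_in_uminus polys_in_mult)
  let ?\<C> = "vertex_covers E"
  have J: "J = mon_span V ?\<C>" using assms(1,4) by (simp add: cover_ideal_eq)
  have up: "upset ?\<C>" using upset_vertex_covers[of E "{}"] by simp
  \<comment> \<open>The induction starts with no variable set to zero: the prime of the empty set is
    the zero ideal and contributes no supports.\<close>
  have "prime_fam {} \<union> ?\<C> = ?\<C>" by (simp add: prime_fam_def)
  then have split: "split_fam V (n - ordered_matching_number E - 1) ?\<C>"
    using split_fam_covers[OF assms(1), of "{}"] assms(2) by simp
  have "enat (n - ordered_matching_number E - 1) \<le> depth (irrelevant_ideal V) (quotient_module S J)"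
  proof (cases "E = {}")
    \<comment> \<open>Now \<open>J = S\<close> and the quotient is zero. No sequence is regular on
      it, as \<open>regular_sequence\<close> asks for a proper submodule; the bound rests on the
      value \<infinity> in \<open>depth\<close>.\<close>
    case True
    have ideal: "is_ideal J" unfolding J by (rule is_ideal_mon_span[OF up])
    have "J = polys_in V" unfolding J using True by (auto simp: vertex_covers_def mon_span_def)
    then have "J +>\<^bsub>poly_ring V\<^esub> p = J +>\<^bsub>poly_ring V\<^esub> 0" if "p \<in> polys_in V" for p
      using that coset_eq_iff[OF ideal, of p 0] by (simp only: diff_zero)
    then have "carrier (quotient_module S J) = {\<zero>\<^bsub>quotient_module S J\<^esub>}"
      unfolding assms(3) Q_carrier[OF ideal] Q_zero[OF ideal]
      using zero_closed by (intro equalityI subsetI) blast+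
    then show ?thesis by (simp add: depth_def)
  next
    case False
    then have "{} \<notin> ?\<C>" by (auto simp: vertex_covers_def)
    then show ?thesis unfolding J assms(3) by (intro depth_quotient_split_fam split up)
  qed
  then show ?thesis
    unfolding J assms(3)
    using sdepth_mon_span[OF up has_partition_covers[OF assms(1)]]
      sdepth_quotient_mon_span[OF up has_partition_complement[OF split]] assms(2)
    by simp
qed

end
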